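(* Let $\alpha\in\mathbb{C}$. Every solution $(x(z),y(z))$ of the second Painlevé equation $$\frac{dx}{dz}=2y^3+yz+\alpha,\qquad \frac{dy}{dz}=x$$ is meromorphic on $\mathbb{C}$; that is, every local holomorphic solution extends to a pair of meromorphic functions on the whole of $\mathbb{C}$.
   Context: The variables $x,y,z$ are complex. A solution is the one determined by an arbitrary initial condition $(x(z_0),y(z_0))=(x_0,y_0)\in\mathbb{C}^2$ at an arbitrary $z_0\in\mathbb{C}$. *)

theory Defs
  imports "HOL-Complex_Analysis.Complex_Analysis"
begin

text \<open>
  The second Painleve equation as the first-order system
  \<open>x' = 2 y^3 + z y + \<alpha>\<close>, \<open>y' = x\<close>. The derivatives are complex, and the predicate is meant
  for open sets \<open>U\<close>; there it implies that \<open>x\<close> and \<open>y\<close> are holomorphic.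
\<close>

definition painleve_II_solution_on ::
    "complex \<Rightarrow> (complex \<Rightarrow> complex) \<Rightarrow> (complex \<Rightarrow> complex) \<Rightarrow> complex set \<Rightarrow> bool" where
  "painleve_II_solution_on \<alpha> x y U \<longleftrightarrow>
     (\<forall>z\<in>U. (x has_field_derivative (2 * y z ^ 3 + y z * z + \<alpha>)) (at z) \<and>
            (y has_field_derivative x z) (at z))"

end

theory Submission
  imports Defs
begin

text \<open>
  A corrected Hamiltonian satisfies a linear differential inequality along segments, hence stays
  bounded by Gronwall's argument, even though \<open>x\<close> and \<open>y\<close> may blow up. Where it is bounded, either \<open>(x, y)\<close>
  is bounded or the state is bounded in one of two charts at infinity in which the equation is
  again polynomial. Picard iteration therefore gives, from every point of a segment, a meromorphic solution on a
  disc of uniform radius, so a meromorphic solution on a disc continues across each boundary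
  point. By compactness the disc can be enlarged, and the maximal disc is the plane.
\<close>

section \<open>Local solutions of polynomial systems\<close>

text \<open>The obstacle is not a single pole but a boundary point at which poles might accumulate:
  local existence alone would give discs whose radii may shrink to 0 on the way there. Hence
  existence is stated with one radius for all initial data below a given bound, and the bound must
  survive passing close to poles, where \<open>y\<close> behaves like 1 / (z - p) or -1 / (z - p).
  These two residues are the reason for two charts.

  A chart is chosen only once per boundary point, at a single point of the segment close to its end,
  so no passage between charts is ever followed. The segment itself must avoid the poles of the
  given solution; they are countable, so a generic segment does.

  Continuation stays single-valued without any monodromy argument, because two discs meet in a
  convex set and solutions that agree near one point of a connected open set agree on all of it.

  The vector fields form an inductive class so that the existence theorem is proved once for the
  original system and for both charts.\<close>

inductive polynomial_field :: "(complex \<Rightarrow> complex \<Rightarrow> complex \<Rightarrow> complex) \<Rightarrow> bool" where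
  const: "polynomial_field (\<lambda>z p q. c)"
| time: "polynomial_field (\<lambda>z p q. z)"
| fst: "polynomial_field (\<lambda>z p q. p)"
| snd: "polynomial_field (\<lambda>z p q. q)"
| add: "polynomial_field F \<Longrightarrow> polynomial_field G \<Longrightarrow> polynomial_field (\<lambda>z p q. F z p q + G z p q)"
| mult: "polynomial_field F \<Longrightarrow> polynomial_field G \<Longrightarrow> polynomial_field (\<lambda>z p q. F z p q * G z p q)"

lemma polynomial_field_power:
  "polynomial_field F \<Longrightarrow> polynomial_field (\<lambda>z p q. F z p q ^ n)"
proof (induction n)
  case 0
  show ?case using polynomial_field.const[of 1] by simp
next
  case (Suc n)
  show ?case using polynomial_field.mult[OF Suc.prems Suc.IH[OF Suc.prems]] by simp
qed

lemma polynomial_field_diff: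
  assumes "polynomial_field F" "polynomial_field G"
  shows "polynomial_field (\<lambda>z p q. F z p q - G z p q)"
  using polynomial_field.add[OF assms(1) polynomial_field.mult[OF polynomial_field.const[of "-1"] assms(2)]]
  by simp

lemmas polynomial_field_intros = polynomial_field.intros polynomial_field_power polynomial_field_diff

lemma polynomial_field_holomorphic:
  assumes "polynomial_field F" "\<phi> holomorphic_on S" "\<psi> holomorphic_on S"
  shows "(\<lambda>z. F z (\<phi> z) (\<psi> z)) holomorphic_on S"
  using assms by induction (auto intro!: holomorphic_intros)

section \<open>Bounds and Lipschitz constants of polynomial fields on bounded sets\<close>

lemma polynomial_field_bounded:
  assumes "polynomial_field F"
  shows "\<exists>M\<ge>0. \<forall>z p q. norm z \<le> B \<longrightarrow> norm p \<le> B \<longrightarrow> norm q \<le> B \<longrightarrow> norm (F z p q) \<le> M"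
  using assms
proof induction
  case (const c)
  show ?case by (rule exI[of _ "norm c"]) auto
next
  case (add F G)
  then obtain M N where MN: "M \<ge> 0" "N \<ge> 0"
    "\<forall>z p q. norm z \<le> B \<longrightarrow> norm p \<le> B \<longrightarrow> norm q \<le> B \<longrightarrow> norm (F z p q) \<le> M"
    "\<forall>z p q. norm z \<le> B \<longrightarrow> norm p \<le> B \<longrightarrow> norm q \<le> B \<longrightarrow> norm (G z p q) \<le> N"
    by blast
  show ?case
    by (rule exI[of _ "M + N"])
      (use MN(1,2) norm_triangle_le[OF add_mono[OF MN(3,4)[rule_format]]] in auto)
next
  case (mult F G)
  then obtain M N where MN: "M \<ge> 0" "N \<ge> 0"
    "\<forall>z p q. norm z \<le> B \<longrightarrow> norm p \<le> B \<longrightarrow> norm q \<le> B \<longrightarrow> norm (F z p q) \<le> M"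
    "\<forall>z p q. norm z \<le> B \<longrightarrow> norm p \<le> B \<longrightarrow> norm q \<le> B \<longrightarrow> norm (G z p q) \<le> N"
    by blast
  show ?case
    by (rule exI[of _ "M * N"], unfold norm_mult)
      (use MN(1,2) mult_mono[OF MN(3,4)[rule_format] MN(1) norm_ge_zero] in auto)
qed (rule exI[of _ "max 0 B"]; auto)+

lemma polynomial_field_Lipschitz:
  assumes "polynomial_field F"
  shows "\<exists>L\<ge>0. \<forall>z p q p' q'. norm z \<le> B \<longrightarrow> norm p \<le> B \<longrightarrow> norm q \<le> B \<longrightarrow> norm p' \<le> B \<longrightarrow> norm q' \<le> B
           \<longrightarrow> norm (F z p q - F z p' q') \<le> L * (norm (p - p') + norm (q - q'))"
  using assms
proof induction
  case (add F G)
  then obtain M N where MN: "M \<ge> 0" "N \<ge> 0"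
    "\<And>z p q p' q'. norm z \<le> B \<Longrightarrow> norm p \<le> B \<Longrightarrow> norm q \<le> B \<Longrightarrow> norm p' \<le> B \<Longrightarrow> norm q' \<le> B
           \<Longrightarrow> norm (F z p q - F z p' q') \<le> M * (norm (p - p') + norm (q - q'))"
    "\<And>z p q p' q'. norm z \<le> B \<Longrightarrow> norm p \<le> B \<Longrightarrow> norm q \<le> B \<Longrightarrow> norm p' \<le> B \<Longrightarrow> norm q' \<le> B
           \<Longrightarrow> norm (G z p q - G z p' q') \<le> N * (norm (p - p') + norm (q - q'))"
    by blast
  show ?case
  proof (rule exI[of _ "M + N"], intro conjI allI impI)
    fix z p q p' q' :: complex
    assume *: "norm z \<le> B" "norm p \<le> B" "norm q \<le> B" "norm p' \<le> B" "norm q' \<le> B"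
    have "norm (F z p q + G z p q - (F z p' q' + G z p' q'))
          \<le> norm (F z p q - F z p' q') + norm (G z p q - G z p' q')"
      by (metis add_diff_add norm_triangle_ineq)
    also have "\<dots> \<le> (M + N) * (norm (p - p') + norm (q - q'))"
      using MN(3)[OF *] MN(4)[OF *] by (simp add: distrib_right)
    finally show "norm (F z p q + G z p q - (F z p' q' + G z p' q')) \<le> (M + N) * (norm (p - p') + norm (q - q'))" .
  qed (simp add: MN(1,2))
next
  case (mult F G)
  then obtain M N where MN: "M \<ge> 0" "N \<ge> 0"
    "\<And>z p q p' q'. norm z \<le> B \<Longrightarrow> norm p \<le> B \<Longrightarrow> norm q \<le> B \<Longrightarrow> norm p' \<le> B \<Longrightarrow> norm q' \<le> B
           \<Longrightarrow> norm (F z p q - F z p' q') \<le> M * (norm (p - p') + norm (q - q'))"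
    "\<And>z p q p' q'. norm z \<le> B \<Longrightarrow> norm p \<le> B \<Longrightarrow> norm q \<le> B \<Longrightarrow> norm p' \<le> B \<Longrightarrow> norm q' \<le> B
           \<Longrightarrow> norm (G z p q - G z p' q') \<le> N * (norm (p - p') + norm (q - q'))"
    by blast
  obtain K where K: "K \<ge> 0" "\<And>z p q. norm z \<le> B \<Longrightarrow> norm p \<le> B \<Longrightarrow> norm q \<le> B \<Longrightarrow> norm (F z p q) \<le> K"
    using polynomial_field_bounded[OF mult.hyps(1)] by blast
  obtain K' where K': "K' \<ge> 0" "\<And>z p q. norm z \<le> B \<Longrightarrow> norm p \<le> B \<Longrightarrow> norm q \<le> B \<Longrightarrow> norm (G z p q) \<le> K'"
    using polynomial_field_bounded[OF mult.hyps(2)] by blast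
  show ?case
  proof (rule exI[of _ "K * N + M * K'"], intro conjI allI impI)
    fix z p q p' q' :: complex
    assume *: "norm z \<le> B" "norm p \<le> B" "norm q \<le> B" "norm p' \<le> B" "norm q' \<le> B"
    let ?d = "norm (p - p') + norm (q - q')"
    have "F z p q * G z p q - F z p' q' * G z p' q'
          = F z p q * (G z p q - G z p' q') + (F z p q - F z p' q') * G z p' q'"
      by (simp add: algebra_simps)
    also have "norm \<dots> \<le> norm (F z p q) * norm (G z p q - G z p' q') + norm (F z p q - F z p' q') * norm (G z p' q')"
      by (metis norm_mult norm_triangle_ineq)
    also have "\<dots> \<le> K * (N * ?d) + (M * ?d) * K'"
      by (intro add_mono mult_mono K(2)[OF *(1-3)] K'(2)[OF *(1,4,5)] MN(3)[OF *] MN(4)[OF *])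
         (simp_all add: MN(1) K(1))
    also have "\<dots> = (K * N + M * K') * ?d"
      by (simp add: algebra_simps)
    finally show "norm (F z p q * G z p q - F z p' q' * G z p' q') \<le> (K * N + M * K') * ?d" .
  qed (simp add: MN(1,2) K(1) K'(1))
next
  case (const c)
  show ?case by (rule exI[of _ 0]) simp
qed (rule exI[of _ 1]; simp)+

lemma polynomial_field_common_bounds:
  assumes "polynomial_field F" "polynomial_field G"
  obtains M L where "M > 0" "L > 0"
    "\<And>z p q. norm z \<le> B \<Longrightarrow> norm p \<le> B \<Longrightarrow> norm q \<le> B \<Longrightarrow> norm (F z p q) \<le> M \<and> norm (G z p q) \<le> M"
    "\<And>z p q p' q'. norm z \<le> B \<Longrightarrow> norm p \<le> B \<Longrightarrow> norm q \<le> B \<Longrightarrow> norm p' \<le> B \<Longrightarrow> norm q' \<le> B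
       \<Longrightarrow> norm (F z p q - F z p' q') \<le> L * (norm (p - p') + norm (q - q')) \<and>
          norm (G z p q - G z p' q') \<le> L * (norm (p - p') + norm (q - q'))"
proof -
  obtain M1 where M1: "M1 \<ge> 0" "\<And>z p q. norm z \<le> B \<Longrightarrow> norm p \<le> B \<Longrightarrow> norm q \<le> B \<Longrightarrow> norm (F z p q) \<le> M1"
    using polynomial_field_bounded[OF assms(1), of B] by metis
  obtain M2 where M2: "M2 \<ge> 0" "\<And>z p q. norm z \<le> B \<Longrightarrow> norm p \<le> B \<Longrightarrow> norm q \<le> B \<Longrightarrow> norm (G z p q) \<le> M2"
    using polynomial_field_bounded[OF assms(2), of B] by metis
  obtain L1 where L1: "L1 \<ge> 0" "\<And>z p q p' q'. norm z \<le> B \<Longrightarrow> norm p \<le> B \<Longrightarrow> norm q \<le> B \<Longrightarrow> norm p' \<le> B \<Longrightarrow> norm q' \<le> B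
       \<Longrightarrow> norm (F z p q - F z p' q') \<le> L1 * (norm (p - p') + norm (q - q'))"
    using polynomial_field_Lipschitz[OF assms(1), of B] by metis
  obtain L2 where L2: "L2 \<ge> 0" "\<And>z p q p' q'. norm z \<le> B \<Longrightarrow> norm p \<le> B \<Longrightarrow> norm q \<le> B \<Longrightarrow> norm p' \<le> B \<Longrightarrow> norm q' \<le> B
       \<Longrightarrow> norm (G z p q - G z p' q') \<le> L2 * (norm (p - p') + norm (q - q'))"
    using polynomial_field_Lipschitz[OF assms(2), of B] by metis
  \<comment> \<open>The summand 1 makes both constants strictly positive, so that their reciprocals
    can serve as radii.\<close>
  show thesis
  proof (rule that[of "M1 + M2 + 1" "L1 + L2 + 1"], goal_cases)
    case (3 z p q)
    then show ?case
      using M1(1) M2(1) M1(2)[OF 3] M2(2)[OF 3] by linarith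
  next
    case (4 z p q p' q')
    have "0 \<le> norm (p - p') + norm (q - q')"
      by simp
    then have "L1 * (norm (p - p') + norm (q - q')) \<le> (L1 + L2 + 1) * (norm (p - p') + norm (q - q'))"
      "L2 * (norm (p - p') + norm (q - q')) \<le> (L1 + L2 + 1) * (norm (p - p') + norm (q - q'))"
      using L1(1) L2(1) by (intro mult_right_mono; linarith)+
    then show ?case
      using L1(2)[OF 4] L2(2)[OF 4] by linarith
  qed (use M1(1) M2(1) L1(1) L2(1) in linarith)+
qed

text \<open>The increments telescope, and their tail from \<open>n\<close> on is dominated by a
  geometric tail. The explicit error matters: with the same \<open>C\<close> at every point of a
  disc, pointwise limits become uniform ones.\<close>

lemma geometric_increments_converge:
  fixes a :: "nat \<Rightarrow> complex"
  assumes "\<And>n. norm (a (Suc n) - a n) \<le> C * (1/2) ^ n"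
  obtains l where "a \<longlonglongrightarrow> l" "\<And>n. norm (a n - l) \<le> 2 * C * (1/2) ^ n"
proof -
  have g: "summable (\<lambda>k. C * (1/2) ^ n * (1/2) ^ k)" for n
    by (intro summable_mult summable_geometric) simp
  have le: "norm (a (Suc (k + n)) - a (k + n)) \<le> C * (1/2) ^ n * (1/2) ^ k" for k n
    using assms[of "k + n"] by (simp add: power_add mult_ac)
  have s: "summable (\<lambda>k. norm (a (Suc (k + n)) - a (k + n)))" for n
    by (rule summable_comparison_test'[OF g[of n], of 0]) (simp only: real_norm_def abs_norm_cancel le)
  have "summable (\<lambda>k. a (Suc k) - a k)"
    using s[of 0] by (rule_tac summable_norm_cancel) simp
  then have "convergent (\<lambda>n. \<Sum>k<n. a (Suc k) - a k)"
    by (simp add: summable_iff_convergent)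
  then have "convergent (\<lambda>n. a n - a 0)"
    by (simp add: sum_lessThan_telescope)
  from convergent_add[OF this convergent_const[of "a 0"]] have "convergent a"
    by simp
  then obtain l where l: "a \<longlonglongrightarrow> l"
    by (auto simp: convergent_def)
  have "norm (a n - l) \<le> 2 * C * (1/2) ^ n" for n
  proof -
    have "(\<lambda>k. a (k + n)) \<longlonglongrightarrow> l"
      using l by (rule LIMSEQ_ignore_initial_segment)
    then have "(\<lambda>k. a (k + n) - a (0 + n)) \<longlonglongrightarrow> l - a n"
      by (auto intro!: tendsto_intros)
    moreover have "(\<Sum>k<m. a (Suc (k + n)) - a (k + n)) = a (m + n) - a (0 + n)" for m
      using sum_lessThan_telescope[of "\<lambda>k. a (k + n)" m] by simp
    ultimately have "(\<lambda>k. a (Suc (k + n)) - a (k + n)) sums (l - a n)"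
      by (simp add: sums_def)
    then have "l - a n = (\<Sum>k. a (Suc (k + n)) - a (k + n))"
      by (rule sums_unique)
    then have "norm (l - a n) \<le> (\<Sum>k. norm (a (Suc (k + n)) - a (k + n)))"
      using summable_norm[OF s[of n]] by (simp only:)
    also have "\<dots> \<le> (\<Sum>k. C * (1/2) ^ n * (1/2) ^ k)"
      by (rule suminf_le[OF le s g])
    also have "\<dots> = C * (1/2) ^ n * 2"
      by (subst suminf_mult) (simp_all add: suminf_geometric summable_geometric)
    finally show ?thesis
      by (simp add: norm_minus_commute mult_ac)
  qed
  with l show thesis
    by (rule that)
qed

text \<open>Picard iteration on holomorphic functions: integration is replaced by taking primitives
  on a disc. The order of quantifiers is the point, since \<open>r\<close> depends on the initial
  data only through \<open>B\<close>.\<close>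

theorem polynomial_field_local_solution:
  assumes F: "polynomial_field F" and G: "polynomial_field G"
  shows "\<exists>r>0. \<forall>z1 p1 q1. norm z1 \<le> B \<longrightarrow> norm p1 \<le> B \<longrightarrow> norm q1 \<le> B \<longrightarrow>
           (\<exists>\<phi> \<psi>. \<phi> z1 = p1 \<and> \<psi> z1 = q1 \<and>
              (\<forall>z\<in>ball z1 r. (\<phi> has_field_derivative F z (\<phi> z) (\<psi> z)) (at z) \<and>
                               (\<psi> has_field_derivative G z (\<phi> z) (\<psi> z)) (at z)))"
proof -
  let ?in = "\<lambda>z p q. norm z \<le> B + 1 \<and> norm p \<le> B + 1 \<and> norm q \<le> B + 1"
  obtain M L where M0: "M > 0" and L0: "L > 0"
    and M': "\<And>z p q. norm z \<le> B + 1 \<Longrightarrow> norm p \<le> B + 1 \<Longrightarrow> norm q \<le> B + 1 \<Longrightarrow> norm (F z p q) \<le> M \<and> norm (G z p q) \<le> M"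
    and L': "\<And>z p q p' q'. norm z \<le> B + 1 \<Longrightarrow> norm p \<le> B + 1 \<Longrightarrow> norm q \<le> B + 1 \<Longrightarrow> norm p' \<le> B + 1 \<Longrightarrow> norm q' \<le> B + 1
       \<Longrightarrow> norm (F z p q - F z p' q') \<le> L * (norm (p - p') + norm (q - q')) \<and>
          norm (G z p q - G z p' q') \<le> L * (norm (p - p') + norm (q - q'))"
    using polynomial_field_common_bounds[OF F G, of "B + 1"] by metis
  have M: "norm (F z p q) \<le> M" "norm (G z p q) \<le> M" if "?in z p q" for z p q
    using M'[of z p q] that by auto
  have LF: "norm (F z p q - F z p' q') \<le> L * (norm (p - p') + norm (q - q'))"
    if "?in z p q" "?in z p' q'" for z p q p' q'
    using L'[of z p q p' q'] that by auto
  have LG: "norm (G z p q - G z p' q') \<le> L * (norm (p - p') + norm (q - q'))"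
    if "?in z p q" "?in z p' q'" for z p q p' q'
    using L'[of z p q p' q'] that by auto
  \<comment> \<open>Each term of the minimum has a task: \<open>r \<le> 1\<close> keeps
    \<open>z\<close> in the box of size \<open>B + 1\<close>, \<open>M * r \<le> 1\<close> keeps
    every iterate within 1 of its initial value, and \<open>4 * L * r \<le> 1\<close> halves the
    increments, because the two components together contribute \<open>2 * L\<close>.\<close>
  define r where "r = min 1 (min (1 / M) (1 / (4 * L)))"
  have r: "r > 0" "r \<le> 1" "M * r \<le> 1" "4 * L * r \<le> 1"
    using M0 L0 by (auto simp: r_def min_def field_simps)
  have "\<exists>\<phi> \<psi>. \<phi> z1 = p1 \<and> \<psi> z1 = q1 \<and>
              (\<forall>z\<in>ball z1 r. (\<phi> has_field_derivative F z (\<phi> z) (\<psi> z)) (at z) \<and>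
                               (\<psi> has_field_derivative G z (\<phi> z) (\<psi> z)) (at z))"
    if z1: "norm z1 \<le> B" and p1: "norm p1 \<le> B" and q1: "norm q1 \<le> B" for z1 p1 q1
  proof -
    define D where "D = ball z1 r"
    have D: "convex D" "open D" "z1 \<in> D"
      using r by (auto simp: D_def)
    have Dz: "norm z \<le> B + 1" if "z \<in> D" for z
    proof -
      have "norm z \<le> norm z1 + norm (z - z1)" by norm
      moreover have "norm (z - z1) \<le> 1" using that r(2) by (auto simp: D_def dist_norm norm_minus_commute)
      ultimately show ?thesis using z1 by linarith
    qed
    \<comment> \<open>The primitive of \<open>f\<close> with value \<open>c\<close> at
      \<open>z1\<close>, playing the part of the integral from \<open>z1\<close>. It exists for
      holomorphic \<open>f\<close> because the disc is convex.\<close>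
    define prim where "prim c f = (SOME g. g z1 = c \<and> (\<forall>z\<in>D. (g has_field_derivative f z) (at z)))"
      for c :: complex and f :: "complex \<Rightarrow> complex"
    have prim: "prim c f z1 = c \<and> (\<forall>z\<in>D. (prim c f has_field_derivative f z) (at z))" if hf: "f holomorphic_on D" for c f
    proof -
      obtain g where g: "\<And>x. x \<in> D \<Longrightarrow> (g has_field_derivative f x) (at x within D)"
        using holomorphic_convex_primitive'[OF D(1,2) hf] by blast
      have "((\<lambda>z. g z + (c - g z1)) has_field_derivative f z) (at z)" if "z \<in> D" for z
        using g[OF that] that D(2) by (auto simp: at_within_open[of _ D] intro!: derivative_eq_intros)
      then have "\<exists>g. g z1 = c \<and> (\<forall>z\<in>D. (g has_field_derivative f z) (at z))"
        by (intro exI[of _ "\<lambda>z. g z + (c - g z1)"]) auto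
      from someI_ex[OF this] show ?thesis
        unfolding prim_def .
    qed
    define s where "s = rec_nat (\<lambda>z. p1, \<lambda>z. q1)
       (\<lambda>n (f, g). (prim p1 (\<lambda>z. F z (f z) (g z)), prim q1 (\<lambda>z. G z (f z) (g z))))"
    define \<phi> where "\<phi> n = fst (s n)" for n
    define \<psi> where "\<psi> n = snd (s n)" for n
    have s0: "\<phi> 0 = (\<lambda>z. p1)" "\<psi> 0 = (\<lambda>z. q1)"
      by (auto simp: \<phi>_def \<psi>_def s_def)
    have sS: "\<phi> (Suc n) = prim p1 (\<lambda>z. F z (\<phi> n z) (\<psi> n z))" "\<psi> (Suc n) = prim q1 (\<lambda>z. G z (\<phi> n z) (\<psi> n z))" for n
      by (auto simp: \<phi>_def \<psi>_def s_def split: prod.splits)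
    have hol: "\<phi> n holomorphic_on D \<and> \<psi> n holomorphic_on D" for n
    proof (induction n)
      case (Suc n)
      then show ?case
        using prim[OF polynomial_field_holomorphic[OF F], of "\<phi> n" "\<psi> n" p1]
          prim[OF polynomial_field_holomorphic[OF G], of "\<phi> n" "\<psi> n" q1]
        by (auto simp: sS holomorphic_on_open D(2) intro: exI)
    qed (auto simp: s0)
    have init: "\<phi> n z1 = p1" "\<psi> n z1 = q1" for n
      using hol prim[OF polynomial_field_holomorphic[OF F]] prim[OF polynomial_field_holomorphic[OF G]]
      by (cases n; auto simp: s0 sS)+
    have der: "(\<phi> (Suc n) has_field_derivative F z (\<phi> n z) (\<psi> n z)) (at z)"
      "(\<psi> (Suc n) has_field_derivative G z (\<phi> n z) (\<psi> n z)) (at z)" if "z \<in> D" for n z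
      using hol prim[OF polynomial_field_holomorphic[OF F]] prim[OF polynomial_field_holomorphic[OF G]] that
      by (auto simp: sS)
    have mvt: "norm (h z - h z1) \<le> K * r"
      if "\<And>z. z \<in> D \<Longrightarrow> (h has_field_derivative h' z) (at z)" "\<And>z. z \<in> D \<Longrightarrow> norm (h' z) \<le> K" "z \<in> D" "K \<ge> 0"
      for h h' K z
    proof -
      have "norm (h z - h z1) \<le> K * norm (z - z1)"
        by (rule field_differentiable_bound[OF D(1), where f' = h'])
           (use that D in \<open>auto intro: has_field_derivative_at_within\<close>)
      also have "\<dots> \<le> K * r"
        using that by (intro mult_left_mono) (auto simp: D_def dist_norm norm_minus_commute)
      finally show ?thesis .
    qed
    have near: "\<forall>z\<in>D. norm (\<phi> n z - p1) \<le> 1 \<and> norm (\<psi> n z - q1) \<le> 1" for n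
    proof (induction n)
      case (Suc n)
      have b: "?in z (\<phi> n z) (\<psi> n z)" if "z \<in> D" for z
        using Suc that Dz[OF that] p1 q1 norm_triangle_sub[of "\<phi> n z" p1] norm_triangle_sub[of "\<psi> n z" q1] by force
      show ?case
      proof
        fix z assume z: "z \<in> D"
        have "norm (\<phi> (Suc n) z - \<phi> (Suc n) z1) \<le> M * r" "norm (\<psi> (Suc n) z - \<psi> (Suc n) z1) \<le> M * r"
          using M[OF b] z M0 by (intro mvt[OF der(1)] mvt[OF der(2)]; simp)+
        then show "norm (\<phi> (Suc n) z - p1) \<le> 1 \<and> norm (\<psi> (Suc n) z - q1) \<le> 1"
          using r by (auto simp: init)
      qed
    qed (auto simp: s0)
    have b: "?in z (\<phi> n z) (\<psi> n z)" if "z \<in> D" for z n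
      using near[of n] that Dz[OF that] p1 q1 norm_triangle_sub[of "\<phi> n z" p1] norm_triangle_sub[of "\<psi> n z" q1] by force
    have incr: "\<forall>z\<in>D. norm (\<phi> (Suc n) z - \<phi> n z) \<le> 1 * (1/2) ^ n \<and> norm (\<psi> (Suc n) z - \<psi> n z) \<le> 1 * (1/2) ^ n" for n
    proof (induction n)
      case 0
      then show ?case using near[of 1] by (auto simp: s0)
    next
      case (Suc n)
      have e: "L * (norm (\<phi> (Suc n) z - \<phi> n z) + norm (\<psi> (Suc n) z - \<psi> n z)) \<le> 2 * L * (1/2) ^ n"
        if "z \<in> D" for z
      proof -
        have "norm (\<phi> (Suc n) z - \<phi> n z) + norm (\<psi> (Suc n) z - \<psi> n z) \<le> 2 * (1/2) ^ n"
          using Suc that by fastforce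
        from mult_left_mono[OF this, of L] L0 show ?thesis by (simp add: mult_ac)
      qed
      have *: "2 * L * (1/2) ^ n * r \<le> 1 * (1/2) ^ Suc n"
        using mult_right_mono[OF r(4), of "(1/2) ^ n"] by (simp add: mult_ac)
      show ?case
      proof
        fix z assume z: "z \<in> D"
        have "norm ((\<phi> (Suc (Suc n)) z - \<phi> (Suc n) z) - (\<phi> (Suc (Suc n)) z1 - \<phi> (Suc n) z1)) \<le> 2 * L * (1/2) ^ n * r"
          by (rule mvt[OF DERIV_diff[OF der(1) der(1)]])
             (use order_trans[OF LF[OF b b] e] z L0 in simp_all)
        moreover have "norm ((\<psi> (Suc (Suc n)) z - \<psi> (Suc n) z) - (\<psi> (Suc (Suc n)) z1 - \<psi> (Suc n) z1)) \<le> 2 * L * (1/2) ^ n * r"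
          by (rule mvt[OF DERIV_diff[OF der(2) der(2)]])
             (use order_trans[OF LG[OF b b] e] z L0 in simp_all)
        ultimately show "norm (\<phi> (Suc (Suc n)) z - \<phi> (Suc n) z) \<le> 1 * (1/2) ^ Suc n \<and>
             norm (\<psi> (Suc (Suc n)) z - \<psi> (Suc n) z) \<le> 1 * (1/2) ^ Suc n"
          using order_trans[OF _ *] by (simp only: init diff_self diff_zero)
      qed
    qed
    have "\<exists>l. (\<lambda>n. \<phi> n z) \<longlonglongrightarrow> l \<and> (\<forall>n. norm (\<phi> n z - l) \<le> 2 * 1 * (1/2) ^ n)" if "z \<in> D" for z
    proof -
      have "norm (\<phi> (Suc n) z - \<phi> n z) \<le> 1 * (1/2) ^ n" for n
        using incr that by blast
      from geometric_increments_converge[OF this] show ?thesis by metis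
    qed
    then obtain \<Phi> where \<Phi>: "\<And>z. z \<in> D \<Longrightarrow> (\<lambda>n. \<phi> n z) \<longlonglongrightarrow> \<Phi> z"
      "\<And>z n. z \<in> D \<Longrightarrow> norm (\<phi> n z - \<Phi> z) \<le> 2 * 1 * (1/2) ^ n" by metis
    have "\<exists>l. (\<lambda>n. \<psi> n z) \<longlonglongrightarrow> l \<and> (\<forall>n. norm (\<psi> n z - l) \<le> 2 * 1 * (1/2) ^ n)" if "z \<in> D" for z
    proof -
      have "norm (\<psi> (Suc n) z - \<psi> n z) \<le> 1 * (1/2) ^ n" for n
        using incr that by blast
      from geometric_increments_converge[OF this] show ?thesis by metis
    qed
    then obtain \<Psi> where \<Psi>: "\<And>z. z \<in> D \<Longrightarrow> (\<lambda>n. \<psi> n z) \<longlonglongrightarrow> \<Psi> z"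
      "\<And>z n. z \<in> D \<Longrightarrow> norm (\<psi> n z - \<Psi> z) \<le> 2 * 1 * (1/2) ^ n" by metis
    have lb: "?in z (\<Phi> z) (\<Psi> z)" if "z \<in> D" for z
      using b that Dz[OF that]
      by (auto intro!: LIMSEQ_le_const2[OF tendsto_norm[OF \<Phi>(1)]] LIMSEQ_le_const2[OF tendsto_norm[OF \<Psi>(1)]])
    have e: "L * (norm (\<phi> n z - \<Phi> z) + norm (\<psi> n z - \<Psi> z)) \<le> 4 * L * (1/2) ^ n" if "z \<in> D" for z n
    proof -
      have "norm (\<phi> n z - \<Phi> z) + norm (\<psi> n z - \<Psi> z) \<le> 4 * (1/2) ^ n"
        using \<Phi>(2)[OF that, of n] \<Psi>(2)[OF that, of n] by linarith
      from mult_left_mono[OF this, of L] L0 show ?thesis by (simp add: mult_ac)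
    qed
    have lim0: "(\<lambda>n. 4 * L * (1/2) ^ n) \<longlonglongrightarrow> 0"
      by (intro tendsto_mult_right_zero LIMSEQ_power_zero) auto
    have small: "\<exists>N. \<forall>n\<ge>N. 4 * L * (1/2) ^ n \<le> \<epsilon>" if "\<epsilon> > 0" for \<epsilon>
      using order_tendstoD(2)[OF lim0 that] unfolding eventually_sequentially by (meson less_imp_le)
    \<comment> \<open>The derivatives of the iterates converge uniformly to \<open>F\<close> along
      the limit, and this already yields differentiability of the limit with the right derivative,
      without passing through an integral equation.\<close>
    have dl: "(\<Phi> has_field_derivative F z (\<Phi> z) (\<Psi> z)) (at z)" if z: "z \<in> D" for z
    proof -
      have "\<exists>g. \<forall>x\<in>D. (\<lambda>n. \<phi> (Suc n) x) \<longlonglongrightarrow> g x \<and> (g has_field_derivative F x (\<Phi> x) (\<Psi> x)) (at x within D)"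
      proof (rule has_complex_derivative_sequence[OF D(1)])
        show "\<exists>N. \<forall>n x. n \<ge> N \<longrightarrow> x \<in> D \<longrightarrow> norm (F x (\<phi> n x) (\<psi> n x) - F x (\<Phi> x) (\<Psi> x)) \<le> \<epsilon>" if "\<epsilon> > 0" for \<epsilon>
        proof -
          obtain N where N: "\<And>n. n \<ge> N \<Longrightarrow> 4 * L * (1/2) ^ n \<le> \<epsilon>"
            using small \<open>\<epsilon> > 0\<close> by blast
          have "norm (F x (\<phi> n x) (\<psi> n x) - F x (\<Phi> x) (\<Psi> x)) \<le> \<epsilon>" if "n \<ge> N" "x \<in> D" for n x
            using order_trans[OF LF[OF b[OF that(2)] lb[OF that(2)]] order_trans[OF e[OF that(2)] N[OF that(1)]]] .
          then show ?thesis by blast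
        qed
        show "\<exists>x l. x \<in> D \<and> (\<lambda>n. \<phi> (Suc n) x) \<longlonglongrightarrow> l"
          using D(3) \<Phi>(1) LIMSEQ_Suc by blast
      qed (use der has_field_derivative_at_within in blast)
      then obtain g where g: "\<And>x. x\<in>D \<Longrightarrow> (\<lambda>n. \<phi> (Suc n) x) \<longlonglongrightarrow> g x"
        "(g has_field_derivative F z (\<Phi> z) (\<Psi> z)) (at z)"
        using z by (metis D(2) at_within_open)
      have "g x = \<Phi> x" if "x \<in> D" for x
        using g(1)[OF that] LIMSEQ_Suc[OF \<Phi>(1)[OF that]] LIMSEQ_unique by blast
      then show ?thesis
        using g(2) z D(2) by (metis has_field_derivative_transform_within_open)
    qed
    have dl': "(\<Psi> has_field_derivative G z (\<Phi> z) (\<Psi> z)) (at z)" if z: "z \<in> D" for z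
    proof -
      have "\<exists>g. \<forall>x\<in>D. (\<lambda>n. \<psi> (Suc n) x) \<longlonglongrightarrow> g x \<and> (g has_field_derivative G x (\<Phi> x) (\<Psi> x)) (at x within D)"
      proof (rule has_complex_derivative_sequence[OF D(1)])
        show "\<exists>N. \<forall>n x. n \<ge> N \<longrightarrow> x \<in> D \<longrightarrow> norm (G x (\<phi> n x) (\<psi> n x) - G x (\<Phi> x) (\<Psi> x)) \<le> \<epsilon>" if "\<epsilon> > 0" for \<epsilon>
        proof -
          obtain N where N: "\<And>n. n \<ge> N \<Longrightarrow> 4 * L * (1/2) ^ n \<le> \<epsilon>"
            using small \<open>\<epsilon> > 0\<close> by blast
          have "norm (G x (\<phi> n x) (\<psi> n x) - G x (\<Phi> x) (\<Psi> x)) \<le> \<epsilon>" if "n \<ge> N" "x \<in> D" for n x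
            using order_trans[OF LG[OF b[OF that(2)] lb[OF that(2)]] order_trans[OF e[OF that(2)] N[OF that(1)]]] .
          then show ?thesis by blast
        qed
        show "\<exists>x l. x \<in> D \<and> (\<lambda>n. \<psi> (Suc n) x) \<longlonglongrightarrow> l"
          using D(3) \<Psi>(1) LIMSEQ_Suc by blast
      qed (use der has_field_derivative_at_within in blast)
      then obtain g where g: "\<And>x. x\<in>D \<Longrightarrow> (\<lambda>n. \<psi> (Suc n) x) \<longlonglongrightarrow> g x"
        "(g has_field_derivative G z (\<Phi> z) (\<Psi> z)) (at z)"
        using z by (metis D(2) at_within_open)
      have "g x = \<Psi> x" if "x \<in> D" for x
        using g(1)[OF that] LIMSEQ_Suc[OF \<Psi>(1)[OF that]] LIMSEQ_unique by blast
      then show ?thesis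
        using g(2) z D(2) by (metis has_field_derivative_transform_within_open)
    qed
    have "\<Phi> z1 = p1" "\<Psi> z1 = q1"
      using \<Phi>(1)[OF D(3)] \<Psi>(1)[OF D(3)] by (auto simp: init LIMSEQ_const_iff)
    then show ?thesis
      using dl dl' by (intro exI[of _ \<Phi>] exI[of _ \<Psi>]) (auto simp: D_def)
  qed
  then show ?thesis
    using r(1) by blast
qed

text \<open>The contraction behind Picard iteration, applied to the difference of two solutions: on
  a small disc any bound on it may be halved, so it vanishes there.\<close>

theorem polynomial_field_unique:
  assumes F: "polynomial_field F" and G: "polynomial_field G"
    and ev: "\<forall>\<^sub>F z in nhds z1. (\<phi> has_field_derivative F z (\<phi> z) (\<psi> z)) (at z) \<and>
                               (\<psi> has_field_derivative G z (\<phi> z) (\<psi> z)) (at z)"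
    and ev': "\<forall>\<^sub>F z in nhds z1. (\<phi>' has_field_derivative F z (\<phi>' z) (\<psi>' z)) (at z) \<and>
                               (\<psi>' has_field_derivative G z (\<phi>' z) (\<psi>' z)) (at z)"
    and eq: "\<phi> z1 = \<phi>' z1" "\<psi> z1 = \<psi>' z1"
  shows "\<forall>\<^sub>F z in nhds z1. \<phi> z = \<phi>' z \<and> \<psi> z = \<psi>' z"
proof -
  \<comment> \<open>Strictly larger than the norms of \<open>z1\<close> and of the common initial
    values, so by continuity both solutions stay in the box of size \<open>B\<close> near
    \<open>z1\<close>.\<close>
  define B where "B = norm z1 + norm (\<phi> z1) + norm (\<psi> z1) + 1"
  have B0: "B > 0" by (simp add: B_def add_nonneg_pos)
  let ?in = "\<lambda>z p q. norm z \<le> B \<and> norm p \<le> B \<and> norm q \<le> B"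
  obtain M L where L0: "L > 0"
    and L': "\<And>z p q p' q'. norm z \<le> B \<Longrightarrow> norm p \<le> B \<Longrightarrow> norm q \<le> B \<Longrightarrow> norm p' \<le> B \<Longrightarrow> norm q' \<le> B
       \<Longrightarrow> norm (F z p q - F z p' q') \<le> L * (norm (p - p') + norm (q - q')) \<and>
          norm (G z p q - G z p' q') \<le> L * (norm (p - p') + norm (q - q'))"
    using polynomial_field_common_bounds[OF F G, of B] by metis
  have LF: "norm (F z p q - F z p' q') \<le> L * (norm (p - p') + norm (q - q'))"
    if "?in z p q" "?in z p' q'" for z p q p' q'
    using L'[of z p q p' q'] that by auto
  have LG: "norm (G z p q - G z p' q') \<le> L * (norm (p - p') + norm (q - q'))"
    if "?in z p q" "?in z p' q'" for z p q p' q'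
    using L'[of z p q p' q'] that by auto
  have bd: "\<forall>\<^sub>F z in nhds z1. norm (f z) \<le> B" if "isCont f z1" "norm (f z1) < B" for f :: "complex \<Rightarrow> complex"
  proof -
    have "(f \<longlongrightarrow> f z1) (nhds z1)"
      using that(1) continuous_within tendsto_at_iff_tendsto_nhds by blast
    from order_tendstoD(2)[OF tendsto_norm[OF this] that(2)] show ?thesis
      by (rule eventually_mono) auto
  qed
  have c: "isCont \<phi> z1" "isCont \<psi> z1" "isCont \<phi>' z1" "isCont \<psi>' z1"
    using eventually_nhds_x_imp_x[OF ev] eventually_nhds_x_imp_x[OF ev'] DERIV_isCont by blast+
  have in1: "\<forall>\<^sub>F z in nhds z1. ?in z (\<phi> z) (\<psi> z) \<and> ?in z (\<phi>' z) (\<psi>' z)"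
  proof -
    have "norm z1 < B" "norm (\<phi> z1) < B" "norm (\<psi> z1) < B" "norm (\<phi>' z1) < B" "norm (\<psi>' z1) < B"
      using norm_ge_zero[of z1] norm_ge_zero[of "\<phi> z1"] norm_ge_zero[of "\<psi> z1"]
      unfolding B_def eq[symmetric] by linarith+
    then show ?thesis
      by (intro eventually_conj bd c continuous_ident)
  qed
  obtain d where d: "d > 0" "\<And>z. dist z z1 < d \<Longrightarrow> ?in z (\<phi> z) (\<psi> z) \<and> ?in z (\<phi>' z) (\<psi>' z)"
    "\<And>z. dist z z1 < d \<Longrightarrow> (\<phi> has_field_derivative F z (\<phi> z) (\<psi> z)) (at z)"
    "\<And>z. dist z z1 < d \<Longrightarrow> (\<psi> has_field_derivative G z (\<phi> z) (\<psi> z)) (at z)"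
    "\<And>z. dist z z1 < d \<Longrightarrow> (\<phi>' has_field_derivative F z (\<phi>' z) (\<psi>' z)) (at z)"
    "\<And>z. dist z z1 < d \<Longrightarrow> (\<psi>' has_field_derivative G z (\<phi>' z) (\<psi>' z)) (at z)"
    using eventually_conj[OF in1 eventually_conj[OF ev ev']] unfolding eventually_nhds_metric by blast
  \<comment> \<open>If both differences are at most b, their derivatives are at most
    \<open>2 * L\<close> times b, and radius \<open>1 / (4 * L)\<close> turns this into b /
    2.\<close>
  define r where "r = min d (1 / (4 * L))"
  have r: "r > 0" "r \<le> d" "4 * L * r \<le> 1"
    using d(1) L0 by (auto simp: r_def min_def field_simps)
  define D where "D = ball z1 r"
  have D: "convex D" "z1 \<in> D" "\<And>z. z \<in> D \<Longrightarrow> dist z z1 < d" "\<And>z. z \<in> D \<Longrightarrow> norm (z - z1) \<le> r"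
    using r by (auto simp: D_def dist_commute dist_norm norm_minus_commute)
  have mvt: "norm (h z - h z1) \<le> K * r"
    if "\<And>z. z \<in> D \<Longrightarrow> (h has_field_derivative h' z) (at z)" "\<And>z. z \<in> D \<Longrightarrow> norm (h' z) \<le> K" "z \<in> D" "K \<ge> 0"
    for h h' K z
  proof -
    have "norm (h z - h z1) \<le> K * norm (z - z1)"
      by (rule field_differentiable_bound[OF D(1), where f' = h'])
         (use that D in \<open>auto intro: has_field_derivative_at_within\<close>)
    also have "\<dots> \<le> K * r"
      using that D by (intro mult_left_mono) auto
    finally show ?thesis .
  qed
  have dec: "\<forall>z\<in>D. norm (\<phi> z - \<phi>' z) \<le> 2 * B * (1/2) ^ n \<and> norm (\<psi> z - \<psi>' z) \<le> 2 * B * (1/2) ^ n" for n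
  proof (induction n)
    case 0
    then show ?case
    proof (intro ballI conjI)
      fix z assume "z \<in> D"
      from d(2)[OF D(3)[OF this]] show "norm (\<phi> z - \<phi>' z) \<le> 2 * B * (1/2) ^ 0"
        using norm_triangle_ineq4[of "\<phi> z" "\<phi>' z"] by simp
      from d(2)[OF D(3)[OF \<open>z \<in> D\<close>]] show "norm (\<psi> z - \<psi>' z) \<le> 2 * B * (1/2) ^ 0"
        using norm_triangle_ineq4[of "\<psi> z" "\<psi>' z"] by simp
    qed
  next
    case (Suc n)
    have e: "L * (norm (\<phi> z - \<phi>' z) + norm (\<psi> z - \<psi>' z)) \<le> 4 * L * B * (1/2) ^ n" if "z \<in> D" for z
    proof -
      have "norm (\<phi> z - \<phi>' z) + norm (\<psi> z - \<psi>' z) \<le> 4 * B * (1/2) ^ n"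
        using Suc that by fastforce
      from mult_left_mono[OF this, of L] L0 show ?thesis by (simp add: mult_ac)
    qed
    have *: "4 * L * B * (1/2) ^ n * r \<le> 2 * B * (1/2) ^ Suc n"
      using mult_right_mono[OF r(3), of "B * (1/2) ^ n"] B0 by (simp add: mult_ac)
    show ?case
    proof
      fix z assume z: "z \<in> D"
      have "norm ((\<phi> z - \<phi>' z) - (\<phi> z1 - \<phi>' z1)) \<le> 4 * L * B * (1/2) ^ n * r"
        by (rule mvt[OF DERIV_diff[OF d(3) d(5)]])
           (use order_trans[OF LF e] D d(2) z L0 B0 in simp_all)
      moreover have "norm ((\<psi> z - \<psi>' z) - (\<psi> z1 - \<psi>' z1)) \<le> 4 * L * B * (1/2) ^ n * r"
        by (rule mvt[OF DERIV_diff[OF d(4) d(6)]])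
           (use order_trans[OF LG e] D d(2) z L0 B0 in simp_all)
      ultimately show "norm (\<phi> z - \<phi>' z) \<le> 2 * B * (1/2) ^ Suc n \<and> norm (\<psi> z - \<psi>' z) \<le> 2 * B * (1/2) ^ Suc n"
        using * eq by auto
    qed
  qed
  have lim0: "(\<lambda>n. 2 * B * (1/2) ^ n) \<longlonglongrightarrow> 0"
    by (intro tendsto_mult_right_zero LIMSEQ_power_zero) auto
  have "\<phi> z = \<phi>' z \<and> \<psi> z = \<psi>' z" if "z \<in> D" for z
    using LIMSEQ_le_const[OF lim0, of "norm (\<phi> z - \<phi>' z)"] LIMSEQ_le_const[OF lim0, of "norm (\<psi> z - \<psi>' z)"] dec that
    by auto
  then show ?thesis
    unfolding eventually_nhds_metric using r(1) by (auto simp: D_def dist_commute)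
qed

section \<open>The corrected Hamiltonian\<close>

text \<open>
  The Hamiltonian \<open>x^2 - y^4 - z y^2 - 2 \<alpha> y\<close> has \<open>z\<close>-derivative \<open>- y^2\<close> along solutions, which is too large near
  poles; there the correction \<open>x / y\<close> cancels it. Replacing \<open>1 / y\<close> by \<open>cnj y / (1 + y cnj y)\<close> keeps this
  cancellation at infinity and removes the singularity at the zeros of \<open>y\<close>. The price is that the result
  is only real differentiable, which suffices along segments.
\<close>

definition lyapunov :: "complex \<Rightarrow> complex \<Rightarrow> complex \<Rightarrow> complex \<Rightarrow> complex" where
  "lyapunov \<alpha> z x y = x ^ 2 - y ^ 4 - z * y ^ 2 - 2 * \<alpha> * y + x * cnj y / (1 + y * cnj y)"

section \<open>Bounds for the correction factor \<open>cnj y / (1 + y * cnj y)\<close> and for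
  \<open>x\<close>\<close>

lemma one_plus_mult_cnj: "1 + y * cnj y = of_real (1 + (norm y)\<^sup>2)"
  by (simp only: of_real_add of_real_1 complex_norm_square)

lemma one_plus_mult_cnj_nonzero [simp]: "1 + y * cnj y \<noteq> 0"
  unfolding one_plus_mult_cnj of_real_eq_0_iff by (metis add_pos_nonneg less_irrefl zero_le_power2 zero_less_one)

lemma norm_one_plus_mult_cnj: "norm (1 + y * cnj y) = 1 + (norm y)\<^sup>2"
  unfolding one_plus_mult_cnj norm_of_real by simp

lemma norm_le_one_plus_square: "norm (y :: complex) \<le> 1 + (norm y)\<^sup>2"
proof -
  have "0 \<le> (norm y - 1/2)\<^sup>2 + 3/4"
    by simp
  then show ?thesis
    by (simp add: power2_eq_square algebra_simps)
qed

lemma norm_cnj_div_le_1: "norm (cnj y / (1 + y * cnj y)) \<le> 1"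
  unfolding norm_divide norm_one_plus_mult_cnj
  using norm_le_one_plus_square[of y] by (simp add: divide_le_eq add_pos_nonneg)

lemma norm_mult_cnj_div_le_1: "norm (y * (cnj y / (1 + y * cnj y))) \<le> 1"
proof -
  have "norm (y * cnj y) = (norm y)\<^sup>2"
    by (simp add: norm_mult power2_eq_square)
  then show ?thesis
    unfolding times_divide_eq_right norm_divide norm_one_plus_mult_cnj by (simp add: divide_le_eq add_pos_nonneg)
qed

text \<open>The definition of \<open>lyapunov\<close> is solved for \<open>x ^ 2\<close>. The only
  term still containing \<open>x\<close> is linear with coefficient of norm at most 1 and is
  absorbed by \<open>2 * norm x \<le> 1 + (norm x)\<^sup>2\<close>, which doubles the remaining
  constants.\<close>

lemma norm_square_le_lyapunov:
  assumes A: "A \<ge> 1" "norm z \<le> A" "norm \<alpha> \<le> A"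
  shows "(norm x)\<^sup>2 \<le> 2 * norm (lyapunov \<alpha> z x y) + 9 * A * (1 + (norm y)\<^sup>2)\<^sup>2"
proof -
  define q where "q = 1 + (norm y)\<^sup>2"
  define \<beta> where "\<beta> = cnj y / (1 + y * cnj y)"
  define W where "W = lyapunov \<alpha> z x y"
  have q1: "q \<ge> 1" by (simp add: q_def)
  have qq: "q \<le> q\<^sup>2" using q1 by (simp add: power2_eq_square mult_le_cancel_left1)
  have y1: "norm y \<le> q\<^sup>2" using order_trans[OF norm_le_one_plus_square[of y, folded q_def] qq] .
  have "(norm y)\<^sup>2 \<le> q" by (simp add: q_def)
  then have y2: "(norm y)\<^sup>2 \<le> q\<^sup>2" using qq by (rule order_trans)
  have "norm y ^ 4 = ((norm y)\<^sup>2)\<^sup>2" by (simp add: power2_eq_square power4_eq_xxxx)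
  also have "\<dots> \<le> q\<^sup>2" by (intro power_mono) (auto simp: q_def)
  finally have y4: "norm y ^ 4 \<le> q\<^sup>2" .
  have "x ^ 2 = W + y ^ 4 + z * y ^ 2 + 2 * \<alpha> * y - x * \<beta>"
    by (simp add: W_def lyapunov_def \<beta>_def)
  then have "(norm x)\<^sup>2 = norm (W + y ^ 4 + z * y ^ 2 + 2 * \<alpha> * y - x * \<beta>)"
    by (metis norm_power)
  also have "\<dots> \<le> norm W + norm (y ^ 4) + norm (z * y ^ 2) + norm (2 * \<alpha> * y) + norm (x * \<beta>)"
    by norm
  also have "norm (y ^ 4) \<le> q\<^sup>2"
    using y4 by (simp add: norm_power)
  also have "norm (z * y ^ 2) \<le> A * q\<^sup>2"
    unfolding norm_mult norm_power using A y2 by (intro mult_mono) auto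
  also have "norm (2 * \<alpha> * y) \<le> 2 * A * q\<^sup>2"
    unfolding norm_mult norm_numeral using A y1 by (intro mult_mono) auto
  also have "norm (x * \<beta>) \<le> norm x"
    unfolding norm_mult \<beta>_def by (intro mult_left_le norm_cnj_div_le_1) simp
  finally have 1: "(norm x)\<^sup>2 \<le> norm W + q\<^sup>2 + A * q\<^sup>2 + 2 * A * q\<^sup>2 + norm x" by simp
  have 2: "2 * norm x \<le> 1 + (norm x)\<^sup>2"
    using zero_le_power2[of "norm x - 1"] by (simp add: power2_eq_square algebra_simps)
  have 3: "q\<^sup>2 \<le> A * q\<^sup>2"
    using A by (simp add: mult_le_cancel_right1)
  have 4: "1 \<le> q\<^sup>2" using q1 qq by linarith
  show ?thesis
    using 1 2 3 4 unfolding W_def q_def mult.assoc by linarith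
qed

text \<open>Along solutions the Hamiltonian contributes only \<open>- (Y ^ 2)\<close>. The rest
  comes from the correction: its derivatives in \<open>x\<close> and in \<open>y\<close> give the
  terms with \<open>\<beta>\<close> and \<open>\<beta> ^ 2\<close>, and its dependence on
  \<open>cnj y\<close> gives the final summand with \<open>cnj (v * X)\<close>.\<close>

lemma lyapunov_has_vector_derivative:
  assumes "(\<gamma> has_vector_derivative v) (at t)"
    and "(x has_field_derivative (2 * y (\<gamma> t) ^ 3 + y (\<gamma> t) * \<gamma> t + \<alpha>)) (at (\<gamma> t))"
    and "(y has_field_derivative x (\<gamma> t)) (at (\<gamma> t))"
  defines "Y \<equiv> y (\<gamma> t)" and "X \<equiv> x (\<gamma> t)"
  defines "\<beta> \<equiv> cnj Y / (1 + Y * cnj Y)"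
  shows "((\<lambda>t. lyapunov \<alpha> (\<gamma> t) (x (\<gamma> t)) (y (\<gamma> t))) has_vector_derivative
           (v * (- (Y ^ 2) + (2 * Y ^ 3 + Y * \<gamma> t + \<alpha>) * \<beta> - \<beta> ^ 2 * X ^ 2) + X * cnj (v * X) / (1 + Y * cnj Y) ^ 2)) (at t)"
proof -
  have x: "((\<lambda>t. x (\<gamma> t)) has_vector_derivative v * (2 * Y ^ 3 + Y * \<gamma> t + \<alpha>)) (at t)"
    using field_vector_diff_chain_at[OF assms(1,2)] by (simp add: o_def Y_def)
  have y: "((\<lambda>t. y (\<gamma> t)) has_vector_derivative v * X) (at t)"
    using field_vector_diff_chain_at[OF assms(1,3)] by (simp add: o_def X_def)
  have cy: "((\<lambda>t. cnj (y (\<gamma> t))) has_vector_derivative cnj (v * X)) (at t)"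
    by (rule has_vector_derivative_cnj[OF y])
  have q: "((\<lambda>t. 1 + y (\<gamma> t) * cnj (y (\<gamma> t))) has_vector_derivative (Y * cnj (v * X) + v * X * cnj Y)) (at t)"
    using has_vector_derivative_add[OF has_vector_derivative_const has_vector_derivative_mult[OF y cy], of 1]
    by (simp add: Y_def)
  have qi: "((\<lambda>t. inverse (1 + y (\<gamma> t) * cnj (y (\<gamma> t)))) has_vector_derivative 
       (Y * cnj (v * X) + v * X * cnj Y) * - (inverse (1 + Y * cnj Y) ^ 2)) (at t)"
    using field_vector_diff_chain_at[OF q DERIV_inverse] by (simp add: o_def Y_def numeral_2_eq_2)
  have "((\<lambda>t. lyapunov \<alpha> (\<gamma> t) (x (\<gamma> t)) (y (\<gamma> t))) has_vector_derivative
      (v * (2 * Y ^ 3 + Y * \<gamma> t + \<alpha>)) * (2 * X) - (v * X) * (4 * Y ^ 3) - (\<gamma> t * ((v * X) * (2 * Y)) + v * Y ^ 2)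
       - 2 * \<alpha> * (v * X) + ((X * cnj Y) * ((Y * cnj (v * X) + v * X * cnj Y) * - (inverse (1 + Y * cnj Y) ^ 2))
         + (X * cnj (v * X) + (v * (2 * Y ^ 3 + Y * \<gamma> t + \<alpha>)) * cnj Y) * inverse (1 + Y * cnj Y))) (at t)"
  proof -
    have 2: "((\<lambda>t. f t ^ 2) has_vector_derivative d * (2 * f t)) (at t)"
      if "(f has_vector_derivative d) (at t)" for f :: "real \<Rightarrow> complex" and d
      using has_vector_derivative_mult[OF that that] by (simp add: power2_eq_square algebra_simps)
    have 4: "((\<lambda>t. f t ^ 4) has_vector_derivative d * (4 * f t ^ 3)) (at t)"
      if "(f has_vector_derivative d) (at t)" for f :: "real \<Rightarrow> complex" and d
      using 2[OF 2[OF that]] by (simp add: power2_eq_square power4_eq_xxxx power3_eq_cube mult_ac)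
    show ?thesis
      unfolding lyapunov_def divide_inverse
      using 2[OF x] 4[OF y] has_vector_derivative_mult[OF assms(1) 2[OF y]]
        has_vector_derivative_mult[OF has_vector_derivative_const y, of "2 * \<alpha>"]
        has_vector_derivative_mult[OF has_vector_derivative_mult[OF x cy] qi]
      unfolding X_def[symmetric] Y_def[symmetric]
      by (auto intro!: has_vector_derivative_add has_vector_derivative_diff)
  qed
  also have "(v * (2 * Y ^ 3 + Y * \<gamma> t + \<alpha>)) * (2 * X) - (v * X) * (4 * Y ^ 3) - (\<gamma> t * ((v * X) * (2 * Y)) + v * Y ^ 2)
       - 2 * \<alpha> * (v * X) + ((X * cnj Y) * ((Y * cnj (v * X) + v * X * cnj Y) * - (inverse (1 + Y * cnj Y) ^ 2))
         + (X * cnj (v * X) + (v * (2 * Y ^ 3 + Y * \<gamma> t + \<alpha>)) * cnj Y) * inverse (1 + Y * cnj Y))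
     = v * (- (Y ^ 2) + (2 * Y ^ 3 + Y * \<gamma> t + \<alpha>) * \<beta> - \<beta> ^ 2 * X ^ 2) + X * cnj (v * X) / (1 + Y * cnj Y) ^ 2"
  proof -
    \<comment> \<open>The conjugates are treated as independent variables;
      \<open>(1 + Y * c) * I = 1\<close> is the only relation that the algebra needs.\<close>
    define c V I where "c = cnj Y" and "V = cnj (v * X)" and "I = inverse (1 + Y * c)"
    have "(1 + Y * c) * I = 1"
      by (simp add: c_def I_def)
    then have "- (X * c * Y * V * I\<^sup>2) + X * V * I = X * V * I\<^sup>2"
      by algebra
    then show ?thesis
      unfolding \<beta>_def divide_inverse power_inverse[symmetric] c_def[symmetric] V_def[symmetric] I_def[symmetric]
      by algebra
  qed
  finally show ?thesis .
qed

text \<open>The bound must be linear in \<open>lyapunov\<close> for Gronwall's argument. What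
  remains of \<open>x\<close> after the cancellation occurs only through \<open>norm x / q\<close>,
  whose square is at most \<open>2 * norm W + 9 * A\<close>.\<close>

lemma lyapunov_derivative_bound:
  fixes x y z \<alpha> v :: complex
  assumes A: "A \<ge> 1" "norm z \<le> A" "norm \<alpha> \<le> A" "norm v \<le> A"
  defines "\<beta> \<equiv> cnj y / (1 + y * cnj y)"
  shows "norm (v * (- (y ^ 2) + (2 * y ^ 3 + y * z + \<alpha>) * \<beta> - \<beta> ^ 2 * x ^ 2) + x * cnj (v * x) / (1 + y * cnj y) ^ 2)
           \<le> 25 * A\<^sup>2 * (1 + norm (lyapunov \<alpha> z x y))"
proof -
  define q where "q = 1 + (norm y)\<^sup>2"
  define W where "W = lyapunov \<alpha> z x y"
  have q1: "q \<ge> 1" by (simp add: q_def)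
  have b1: "norm \<beta> \<le> 1" "norm (y * \<beta>) \<le> 1"
    unfolding \<beta>_def by (rule norm_cnj_div_le_1 norm_mult_cnj_div_le_1)+
  then have b1': "norm y * norm \<beta> \<le> 1" by (simp add: norm_mult)
  have "norm \<beta> ^ 2 = (norm y)\<^sup>2 / q\<^sup>2"
    unfolding \<beta>_def norm_divide norm_one_plus_mult_cnj q_def[symmetric] by (simp add: power_divide)
  also have "\<dots> \<le> q / q\<^sup>2"
    by (intro divide_right_mono) (auto simp: q_def)
  also have "\<dots> = 1 / q" using q1 by (simp add: power2_eq_square)
  finally have b2: "norm \<beta> ^ 2 \<le> 1 / q" .
  have "(norm x / q)\<^sup>2 = (norm x)\<^sup>2 / q\<^sup>2" by (simp add: power_divide)
  also have "\<dots> \<le> (2 * norm W + 9 * A * q\<^sup>2) / q\<^sup>2"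
    using norm_square_le_lyapunov[OF A(1-3), of x y] by (intro divide_right_mono) (auto simp: q_def W_def)
  also have "\<dots> = 2 * norm W / q\<^sup>2 + 9 * A"
    using q1 by (simp add: add_divide_distrib)
  also have "2 * norm W / q\<^sup>2 \<le> 2 * norm W"
    using q1 mult_left_mono[of 1 "q\<^sup>2" "2 * norm W"] by (simp add: divide_le_eq)
  finally have x2: "(norm x / q)\<^sup>2 \<le> 2 * norm W + 9 * A" by simp
  have x1: "norm x / q \<le> 1 + (norm x / q)\<^sup>2"
    using zero_le_power2[of "norm x / q - 1/2"] by (simp add: power2_eq_square algebra_simps)
  have yq: "y - \<beta> * y ^ 2 = y / (1 + y * cnj y)"
    unfolding \<beta>_def by (simp add: field_simps power2_eq_square)
  have n1: "norm ((y / (1 + y * cnj y)) ^ 2) \<le> 1"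
  proof -
    have "norm (y / (1 + y * cnj y)) \<le> 1"
      using norm_cnj_div_le_1[of y] by (simp add: norm_divide)
    then show ?thesis
      unfolding norm_power by (intro power_le_one) auto
  qed
  have xx: "x ^ 2 = W + y ^ 4 + z * y ^ 2 + 2 * \<alpha> * y - x * \<beta>"
    by (simp add: W_def lyapunov_def \<beta>_def)
  \<comment> \<open>Once \<open>x ^ 2\<close> is eliminated through \<open>W\<close>, the dangerous
    terms - y^2 + 2 \<beta> y^3 - \<beta>^2 y^4 form a perfect square, and y - \<beta> y^2 equals y
    / (1 + |y|^2), which is bounded. This is the cancellation for which the correction was
    introduced.\<close>
  have "- (y ^ 2) + (2 * y ^ 3 + y * z + \<alpha>) * \<beta> - \<beta> ^ 2 * x ^ 2 =
     - ((y - \<beta> * y ^ 2) ^ 2) + z * (y * \<beta>) + \<alpha> * \<beta> - \<beta> ^ 2 * W - z * (y * \<beta>) ^ 2 - 2 * \<alpha> * \<beta> * (y * \<beta>) + \<beta> ^ 3 * x"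
    unfolding xx by (simp add: algebra_simps power2_eq_square power3_eq_cube power4_eq_xxxx)
  also have "norm \<dots> \<le> norm ((y - \<beta> * y ^ 2) ^ 2) + norm (z * (y * \<beta>)) + norm (\<alpha> * \<beta>) + norm (\<beta> ^ 2 * W)
      + norm (z * (y * \<beta>) ^ 2) + norm (2 * \<alpha> * \<beta> * (y * \<beta>)) + norm (\<beta> ^ 3 * x)"
    by norm
  also have "norm ((y - \<beta> * y ^ 2) ^ 2) \<le> 1" unfolding yq by (rule n1)
  also have "norm (z * (y * \<beta>)) \<le> A * 1" unfolding norm_mult[of z] using A b1' by (intro mult_mono) (auto simp: norm_mult)
  also have "norm (\<alpha> * \<beta>) \<le> A * 1" unfolding norm_mult[of \<alpha>] using A b1 by (intro mult_mono) auto
  also have "norm (\<beta> ^ 2 * W) \<le> 1 * norm W" unfolding norm_mult norm_power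
    using b1 by (intro mult_right_mono power_le_one) auto
  also have "norm (z * (y * \<beta>) ^ 2) \<le> A * 1" unfolding norm_mult[of z] norm_power
    using A b1' by (intro mult_mono power_le_one) (auto simp: norm_mult)
  also have "norm (2 * \<alpha> * \<beta> * (y * \<beta>)) \<le> 2 * A * 1 * 1"
    unfolding norm_mult[of _ "y * \<beta>"] norm_mult[of _ \<beta>] norm_mult[of 2] norm_numeral
    using A b1 b1' by (intro mult_mono) (auto simp: norm_mult)
  also have "norm (\<beta> ^ 3 * x) \<le> norm x / q"
  proof -
    have "norm (\<beta> ^ 3 * x) = norm \<beta> * (norm \<beta> ^ 2 * norm x)"
      by (simp add: norm_mult norm_power power2_eq_square power3_eq_cube)
    also have "\<dots> \<le> 1 * (1 / q * norm x)"
      using b1 b2 q1 by (intro mult_mono) auto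
    finally show ?thesis by simp
  qed
  finally have main: "norm (- (y ^ 2) + (2 * y ^ 3 + y * z + \<alpha>) * \<beta> - \<beta> ^ 2 * x ^ 2) \<le> 2 + 14 * A + 3 * norm W"
    using x1 x2 by linarith
  have "norm (x * cnj (v * x) / (1 + y * cnj y) ^ 2) = norm v * (norm x / q)\<^sup>2"
    unfolding norm_divide norm_power norm_one_plus_mult_cnj q_def[symmetric]
    by (simp add: norm_mult power2_eq_square)
  also have "\<dots> \<le> A * (2 * norm W + 9 * A)"
    using A x2 by (intro mult_mono) auto
  finally have rest: "norm (x * cnj (v * x) / (1 + y * cnj y) ^ 2) \<le> A * (2 * norm W + 9 * A)" .
  have "norm (v * (- (y ^ 2) + (2 * y ^ 3 + y * z + \<alpha>) * \<beta> - \<beta> ^ 2 * x ^ 2)) \<le> A * (2 + 14 * A + 3 * norm W)"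
    unfolding norm_mult[of v] using A main by (intro mult_mono) auto
  then have "norm (v * (- (y ^ 2) + (2 * y ^ 3 + y * z + \<alpha>) * \<beta> - \<beta> ^ 2 * x ^ 2) + x * cnj (v * x) / (1 + y * cnj y) ^ 2)
       \<le> A * (2 + 14 * A + 3 * norm W) + A * (2 * norm W + 9 * A)"
    using rest norm_triangle_mono by blast
  also have "\<dots> = A * (2 + 23 * A + 5 * norm W)" by (simp add: algebra_simps)
  also have "\<dots> \<le> A * (25 * A * (1 + norm W))"
  proof (rule mult_left_mono)
    have "norm W \<le> A * norm W" using A(1) by (simp add: mult_le_cancel_right1)
    moreover have "0 \<le> norm W" by simp
    ultimately have "2 + 23 * A + 5 * norm W \<le> 25 * A + 25 * (A * norm W)" using A(1) by linarith
    then show "2 + 23 * A + 5 * norm W \<le> 25 * A * (1 + norm W)" by (simp add: algebra_simps)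
  qed (use A in auto)
  finally show ?thesis
    by (simp add: W_def power2_eq_square mult.assoc)
qed

section \<open>Gronwall's argument for vector-valued functions\<close>

lemma add_square_le: "n + n\<^sup>2 \<le> 2 * (1 + n\<^sup>2)" for n :: real
proof -
  have "0 \<le> (n - 1/2)\<^sup>2 + 7/4"
    by simp
  then show ?thesis
    by (simp add: power2_eq_square algebra_simps)
qed

text \<open>The norm need not be differentiable where \<open>W\<close> vanishes, so
  \<open>N = 1 + W \<bullet> W\<close> is used instead; its summand 1 turns the affine bound into N'
  \<le> 4 C N. Hence N exp (- 4 C t) does not increase, and the bound is uniform up to the excluded
  endpoint 1.\<close>

lemma Gronwall_bounded:
  fixes W :: "real \<Rightarrow> 'a::real_inner"
  assumes der: "\<And>t. t \<in> {0..<1} \<Longrightarrow> (W has_vector_derivative W' t) (at t)"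
    and bd: "\<And>t. t \<in> {0..<1} \<Longrightarrow> norm (W' t) \<le> C * (1 + norm (W t))"
    and C: "C \<ge> 0"
  shows "\<exists>K. \<forall>t\<in>{0..<1}. norm (W t) \<le> K"
proof -
  define N where "N t = 1 + W t \<bullet> W t" for t
  have N: "N t = 1 + (norm (W t))\<^sup>2" for t
    by (simp add: N_def power2_norm_eq_inner)
  have dN: "(N has_real_derivative 2 * (W t \<bullet> W' t)) (at t)" if "t \<in> {0..<1}" for t
  proof -
    have "(W has_derivative (\<lambda>h. h *\<^sub>R W' t)) (at t)"
      using der[OF that] by (simp add: has_vector_derivative_def)
    from has_derivative_add[OF has_derivative_const[of 1] has_derivative_inner[OF this this]]
    have "((\<lambda>t. 1 + W t \<bullet> W t) has_derivative (\<lambda>h. 2 * (W t \<bullet> W' t) * h)) (at t)"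
      by (simp add: inner_commute algebra_simps)
    then show ?thesis
      unfolding N_def[abs_def] has_field_derivative_def .
  qed
  have dle: "2 * (W t \<bullet> W' t) \<le> 4 * C * N t" if "t \<in> {0..<1}" for t
  proof -
    have "W t \<bullet> W' t \<le> norm (W t) * norm (W' t)"
      by (rule norm_cauchy_schwarz)
    also have "\<dots> \<le> norm (W t) * (C * (1 + norm (W t)))"
      by (intro mult_left_mono bd that) auto
    also have "\<dots> = C * (norm (W t) + (norm (W t))\<^sup>2)"
      by (simp add: algebra_simps power2_eq_square)
    also have "\<dots> \<le> C * (2 * N t)"
    proof (rule mult_left_mono[OF _ C])
      show "norm (W t) + (norm (W t))\<^sup>2 \<le> 2 * N t"
        unfolding N by (rule add_square_le)
    qed
    finally show ?thesis by simp
  qed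
  have "norm (W t) \<le> N 0 * exp (4 * C)" if t: "t \<in> {0..<1}" for t
  proof -
    define g where "g t = N t * exp (- (4 * C * t))" for t
    have "g t \<le> g 0"
    proof (rule DERIV_nonpos_imp_nonincreasing[of 0 t g])
      fix s assume s: "0 \<le> s" "s \<le> t"
      then have s': "s \<in> {0..<1}" using t by auto
      have "(g has_real_derivative (2 * (W s \<bullet> W' s) - 4 * C * N s) * exp (- (4 * C * s))) (at s)"
        unfolding g_def[abs_def] by (rule derivative_eq_intros dN[OF s'] refl | simp add: algebra_simps)+
      moreover have "(2 * (W s \<bullet> W' s) - 4 * C * N s) * exp (- (4 * C * s)) \<le> 0"
        using dle[OF s'] by (intro mult_nonpos_nonneg) auto
      ultimately show "\<exists>y. (g has_real_derivative y) (at s) \<and> y \<le> 0" by blast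
    qed (use t in auto)
    then have "N t * exp (- (4 * C * t)) \<le> N 0"
      by (simp add: g_def)
    then have "N t \<le> N 0 * exp (4 * C * t)"
      by (simp add: exp_minus divide_simps)
    also have "\<dots> \<le> N 0 * exp (4 * C)"
      using C t by (intro mult_left_mono) (auto simp: N mult_left_le)
    finally have "N t \<le> N 0 * exp (4 * C)" .
    moreover have "norm (W t) \<le> N t"
      unfolding N using zero_le_power2[of "norm (W t) - 1/2"] by (simp add: power2_eq_square algebra_simps)
    ultimately show ?thesis by linarith
  qed
  then show ?thesis by blast
qed

section \<open>Charts at infinity\<close>

text \<open>The system at a single point, so that the singular set of a solution can be described as
  the set where this fails.\<close>

definition painleve_ode :: "complex \<Rightarrow> (complex \<Rightarrow> complex) \<Rightarrow> (complex \<Rightarrow> complex) \<Rightarrow> complex \<Rightarrow> bool" where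
  "painleve_ode \<alpha> x y z \<longleftrightarrow>
     (x has_field_derivative (2 * y z ^ 3 + y z * z + \<alpha>)) (at z) \<and> (y has_field_derivative x z) (at z)"

text \<open>Poles carry the value \<open>0\<close>, the convention of \<open>nicely_meromorphic_on\<close>.\<close>

definition meromorphic_solution_at :: "complex \<Rightarrow> (complex \<Rightarrow> complex) \<Rightarrow> (complex \<Rightarrow> complex) \<Rightarrow> complex \<Rightarrow> bool" where
  "meromorphic_solution_at \<alpha> x y p \<longleftrightarrow> (\<forall>\<^sub>F z in at p. painleve_ode \<alpha> x y z) \<and>
     (painleve_ode \<alpha> x y p \<or> (x p = 0 \<and> y p = 0 \<and> is_pole x p \<and> is_pole y p))"

text \<open>
  Coordinates \<open>(u, w)\<close> with \<open>y = 1 / u\<close> and \<open>x = chart_x \<epsilon> \<alpha> z u w\<close>, \<open>\<epsilon> = 1\<close> or \<open>-1\<close>, turn the equation into the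
  polynomial system \<open>u' = chart_field_u\<close>, \<open>w' = chart_field_w\<close>. Poles of \<open>y\<close> of residue \<open>- \<epsilon>\<close> become simple zeros of \<open>u\<close>;
  the value of \<open>w\<close> there corresponds to the coefficient left free in the Laurent expansion.
\<close>

definition chart_x :: "complex \<Rightarrow> complex \<Rightarrow> complex \<Rightarrow> complex \<Rightarrow> complex \<Rightarrow> complex" where
  "chart_x \<epsilon> \<alpha> z u w = \<epsilon> * (1 / u ^ 2 + z / 2 + (\<alpha> - \<epsilon> / 2) * u + w * u ^ 2)"

definition chart_field_u :: "complex \<Rightarrow> complex \<Rightarrow> complex \<Rightarrow> complex \<Rightarrow> complex \<Rightarrow> complex" where
  "chart_field_u \<epsilon> \<alpha> z u w = - \<epsilon> * (1 + z * u ^ 2 / 2 + (\<alpha> - \<epsilon> / 2) * u ^ 3 + w * u ^ 4)"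

definition chart_field_w :: "complex \<Rightarrow> complex \<Rightarrow> complex \<Rightarrow> complex \<Rightarrow> complex \<Rightarrow> complex" where
  "chart_field_w \<epsilon> \<alpha> z u w = \<epsilon> * (\<alpha> - \<epsilon> / 2 + 2 * u * w) * (z / 2 + (\<alpha> - \<epsilon> / 2) * u + w * u ^ 2)"

section \<open>From solutions in a chart to meromorphic solutions\<close>

lemma polynomial_field_chart:
  "polynomial_field (chart_field_u \<epsilon> \<alpha>)" "polynomial_field (chart_field_w \<epsilon> \<alpha>)"
  unfolding chart_field_u_def[abs_def] chart_field_w_def[abs_def] divide_inverse
  by (intro polynomial_field_intros)+

lemma polynomial_field_painleve:
  "polynomial_field (\<lambda>z x y. 2 * y ^ 3 + y * z + \<alpha>)" "polynomial_field (\<lambda>z x y. x)"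
  by (intro polynomial_field_intros)+

text \<open>\<open>X\<close> is prescribed only where \<open>u\<close> is nonzero, so that the
  function reset to 0 at the zeros of \<open>u\<close> is covered as well.\<close>

lemma painleve_ode_chart:
  assumes e: "\<epsilon> = 1 \<or> \<epsilon> = -1"
    and u: "(u has_field_derivative chart_field_u \<epsilon> \<alpha> z (u z) (w z)) (at z)"
    and w: "(w has_field_derivative chart_field_w \<epsilon> \<alpha> z (u z) (w z)) (at z)"
    and nz: "u z \<noteq> 0"
    and X: "\<And>z. u z \<noteq> 0 \<Longrightarrow> X z = chart_x \<epsilon> \<alpha> z (u z) (w z)"
  shows "painleve_ode \<alpha> X (\<lambda>z. 1 / u z) z"
proof -
  have ev: "\<forall>\<^sub>F z in nhds z. X z = chart_x \<epsilon> \<alpha> z (u z) (w z)"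
  proof -
    have "\<forall>\<^sub>F z in at z. u z \<noteq> 0"
      using DERIV_isCont[OF u] nz unfolding isCont_def by (rule tendsto_imp_eventually_ne)
    then have "\<forall>\<^sub>F z in nhds z. u z \<noteq> 0"
      using nz by (simp add: eventually_nhds_conv_at)
    then show ?thesis
      by (rule eventually_mono) (rule X)
  qed
  \<comment> \<open>This value is forced. In the equation for x', after u' is substituted, the terms
    of order 0 in \<open>u\<close> cancel exactly for this \<open>c\<close>, and those of order 1
    cancel for every \<open>w\<close>. What is left is divisible by \<open>u ^ 2\<close>, so the
    equation for \<open>w\<close> is polynomial.\<close>
  define c where "c = \<alpha> - \<epsilon> / 2"
  have dx: "((\<lambda>z. chart_x \<epsilon> \<alpha> z (u z) (w z)) has_field_derivative
     \<epsilon> * (- (2 * chart_field_u \<epsilon> \<alpha> z (u z) (w z) / u z ^ 3) + 1 / 2 + c * chart_field_u \<epsilon> \<alpha> z (u z) (w z)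
        + (chart_field_w \<epsilon> \<alpha> z (u z) (w z) * u z ^ 2 + w z * (2 * u z * chart_field_u \<epsilon> \<alpha> z (u z) (w z))))) (at z)"
    unfolding chart_x_def c_def[symmetric]
    apply (rule derivative_eq_intros u w refl nz power_not_zero | simp add: nz)+
    using nz by (simp add: divide_simps power2_eq_square power3_eq_cube power4_eq_xxxx)
  have "(X has_field_derivative 2 * (1 / u z) ^ 3 + 1 / u z * z + \<alpha>) (at z)"
  proof -
    have "\<epsilon> * (- (2 * chart_field_u \<epsilon> \<alpha> z (u z) (w z) / u z ^ 3) + 1 / 2 + c * chart_field_u \<epsilon> \<alpha> z (u z) (w z)
        + (chart_field_w \<epsilon> \<alpha> z (u z) (w z) * u z ^ 2 + w z * (2 * u z * chart_field_u \<epsilon> \<alpha> z (u z) (w z))))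
        = 2 * (1 / u z) ^ 3 + 1 / u z * z + \<alpha>"
      using e nz unfolding chart_field_u_def chart_field_w_def c_def
      by (elim disjE; simp add: divide_simps; simp add: algebra_simps power2_eq_square power3_eq_cube power4_eq_xxxx)
    then show ?thesis
      using dx DERIV_cong_ev[OF refl ev refl] by simp
  qed
  moreover have "((\<lambda>z. 1 / u z) has_field_derivative X z) (at z)"
  proof -
    have "((\<lambda>z. 1 / u z) has_field_derivative - chart_field_u \<epsilon> \<alpha> z (u z) (w z) / u z ^ 2) (at z)"
      by (rule derivative_eq_intros u refl nz | simp add: power2_eq_square)+
    moreover have "- chart_field_u \<epsilon> \<alpha> z (u z) (w z) / u z ^ 2 = X z"
      unfolding X[OF nz] chart_field_u_def chart_x_def c_def[symmetric] using nz
      by (simp add: divide_simps) (simp add: algebra_simps power2_eq_square power3_eq_cube power4_eq_xxxx)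
    ultimately show ?thesis by simp
  qed
  ultimately show ?thesis
    unfolding painleve_ode_def by blast
qed

text \<open>At a zero of \<open>u\<close> the chart equation gives the derivative - \<epsilon>,
  which is not 0. Zeros are therefore isolated, and both functions have poles there:
  \<open>u ^ 2\<close> times \<open>chart_x\<close> tends to \<epsilon>.\<close>

lemma meromorphic_solution_at_chart:
  assumes e: "\<epsilon> = 1 \<or> \<epsilon> = -1" and S: "open S" "p \<in> S"
    and u: "\<And>z. z \<in> S \<Longrightarrow> (u has_field_derivative chart_field_u \<epsilon> \<alpha> z (u z) (w z)) (at z)"
    and w: "\<And>z. z \<in> S \<Longrightarrow> (w has_field_derivative chart_field_w \<epsilon> \<alpha> z (u z) (w z)) (at z)"
  shows "meromorphic_solution_at \<alpha> (\<lambda>z. if u z = 0 then 0 else chart_x \<epsilon> \<alpha> z (u z) (w z)) (\<lambda>z. 1 / u z) p"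
    (is "meromorphic_solution_at \<alpha> ?X ?Y p")
proof -
  have ode: "painleve_ode \<alpha> ?X ?Y z" if "z \<in> S" "u z \<noteq> 0" for z
    by (rule painleve_ode_chart[OF e u w]) (use that in auto)
  have cu: "isCont u p" "isCont w p"
    using DERIV_isCont u w S(2) by blast+
  have ne: "\<forall>\<^sub>F z in at p. u z \<noteq> 0"
  proof (cases "u p = 0")
    case False
    then show ?thesis
      using cu(1) tendsto_imp_eventually_ne unfolding isCont_def by blast
  next
    case True
    then have "((\<lambda>z. (u z - 0) / (z - p)) \<longlongrightarrow> - \<epsilon>) (at p)"
      using u[OF S(2)] unfolding has_field_derivative_iff chart_field_u_def by simp
    then have "\<forall>\<^sub>F z in at p. (u z - 0) / (z - p) \<noteq> 0"
      by (rule tendsto_imp_eventually_ne) (use e in auto)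
    then show ?thesis
      by (rule eventually_mono) auto
  qed
  have "\<forall>\<^sub>F z in at p. painleve_ode \<alpha> ?X ?Y z"
    using ne eventually_at_in_open'[OF S] by eventually_elim (rule ode)
  moreover have "is_pole ?X p \<and> is_pole ?Y p" if "u p = 0"
  proof
    have lim: "filterlim u (at 0) (at p)"
      using cu(1) that ne by (auto simp: filterlim_at isCont_def)
    show "is_pole ?Y p"
      by (rule is_pole_divide[OF _ lim]) auto
    have lim2: "filterlim (\<lambda>z. u z ^ 2) (at 0) (at p)"
      unfolding filterlim_at
    proof
      show "\<forall>\<^sub>F z in at p. u z ^ 2 \<in> UNIV \<and> u z ^ 2 \<noteq> 0"
        using ne by eventually_elim auto
      have "((\<lambda>z. u z ^ 2) \<longlongrightarrow> u p ^ 2) (at p)"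
        using cu(1) unfolding isCont_def by (rule tendsto_power)
      then show "((\<lambda>z. u z ^ 2) \<longlongrightarrow> 0) (at p)"
        using that by simp
    qed
    have "is_pole (\<lambda>z. (\<epsilon> * (1 + z / 2 * u z ^ 2 + (\<alpha> - \<epsilon> / 2) * u z ^ 3 + w z * u z ^ 4)) / u z ^ 2) p"
      by (rule is_pole_divide[OF _ lim2]) (use that e cu in \<open>auto intro!: continuous_intros\<close>)
    then show "is_pole ?X p"
    proof (rule is_pole_transform)
      show "\<forall>\<^sub>F z in at p. (\<epsilon> * (1 + z / 2 * u z ^ 2 + (\<alpha> - \<epsilon> / 2) * u z ^ 3 + w z * u z ^ 4)) / u z ^ 2 = ?X z"
        using ne by eventually_elim
          (simp add: chart_x_def field_simps power2_eq_square power3_eq_cube power4_eq_xxxx)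
    qed simp
  qed
  ultimately show ?thesis
    unfolding meromorphic_solution_at_def using ode[OF S(2)] by auto
qed

text \<open>Dividing the definition of \<open>lyapunov\<close> by y^4 shows that \<xi> = x / y^2
  satisfies \<xi>^2 = 1 + O(u^2), so \<xi> is close to 1 or to -1, and this sign selects the chart.
  Expanding to fourth order, the lower terms are those of \<open>chart_x\<close>; the correction in
  \<open>lyapunov\<close> supplies the summand - \<epsilon> / 2 at order u^3, so \<open>w\<close>
  remains bounded. The threshold \<open>2 + C\<close> ensures |u| \<le> 1/2 and C |u|^2 \<le>
  1.\<close>

lemma lyapunov_bounded_chart:
  assumes A: "norm z \<le> A" "norm \<alpha> \<le> A" and K: "norm (lyapunov \<alpha> z x y) \<le> K"
  defines "C \<equiv> 3 * A + K + 2"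
  assumes y: "norm y \<ge> 2 + C"
  shows "\<exists>\<epsilon> u w. (\<epsilon> = 1 \<or> \<epsilon> = -1) \<and> u \<noteq> 0 \<and> y = 1 / u \<and> x = chart_x \<epsilon> \<alpha> z u w \<and>
          norm u \<le> 1 \<and> norm w \<le> K + C\<^sup>2 + C + 1"
proof -
  define W where "W = lyapunov \<alpha> z x y"
  have A0: "A \<ge> 0" "K \<ge> 0" "norm W \<le> K"
    using A K norm_ge_zero order_trans unfolding W_def by blast+
  then have C0: "C \<ge> 2" by (simp add: C_def)
  have y0: "y \<noteq> 0" using y C0 by auto
  define u where "u = 1 / y"
  have u0: "u \<noteq> 0" and yu: "y = 1 / u" using y0 by (auto simp: u_def)
  have "norm u * (2 + C) \<le> norm u * norm y"
    using y by (intro mult_left_mono) auto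
  also have "\<dots> = 1" using y0 by (simp add: u_def norm_divide)
  finally have uC: "norm u * 2 + norm u * C \<le> 1" by (simp add: algebra_simps)
  have "0 \<le> norm u * C" using C0 by simp
  with uC have u2: "norm u \<le> 1 / 2" by linarith
  then have u1: "norm u \<le> 1" by simp
  have Cu: "C * (norm u)\<^sup>2 \<le> 1"
  proof -
    have "C * (norm u)\<^sup>2 = (norm u * C) * norm u" by (simp add: power2_eq_square)
    also have "\<dots> \<le> 1 * 1"
    proof (rule mult_mono)
      show "norm u * C \<le> 1" using uC norm_ge_zero[of u] by linarith
    qed (use u1 in auto)
    finally show ?thesis by simp
  qed
  define s where "s = 1 / (1 + u * cnj u)"
  have s1: "norm s \<le> 1"
    unfolding s_def norm_divide norm_one_plus_mult_cnj by (simp add: divide_le_eq add_pos_nonneg)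
  have su: "1 - s = u * cnj u * s" by (simp add: s_def field_simps)
  define \<xi> where "\<xi> = x * u ^ 2"
  have cy: "cnj y / (1 + y * cnj y) = u * s"
    unfolding yu s_def using u0 by (simp add: divide_simps) (simp add: algebra_simps)
  have xeq: "x ^ 2 = W + y ^ 4 + z * y ^ 2 + 2 * \<alpha> * y - x * (u * s)"
    by (simp add: W_def lyapunov_def cy[symmetric])
  have yu1: "y * u = 1" using u0 yu by simp
  have xi2: "\<xi> ^ 2 - 1 = z * u ^ 2 + 2 * \<alpha> * u ^ 3 + W * u ^ 4 - \<xi> * u ^ 3 * s"
    using xeq yu1 unfolding \<xi>_def by algebra
  have p: "norm u ^ 3 \<le> norm u ^ 2" "norm u ^ 4 \<le> norm u ^ 2" "norm u ^ 5 \<le> norm u ^ 4"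
    using u1 by (auto intro!: power_decreasing)
  have n: "norm (\<xi> ^ 2 - 1) \<le> (3 * A + K) * norm u ^ 2 + norm \<xi> * norm u ^ 3"
  proof -
    have "norm (\<xi> ^ 2 - 1) \<le> norm (z * u ^ 2) + norm (2 * \<alpha> * u ^ 3) + norm (W * u ^ 4) + norm (\<xi> * u ^ 3 * s)"
      unfolding xi2 by norm
    also have "norm (z * u ^ 2) \<le> A * norm u ^ 2"
      unfolding norm_mult norm_power using A A0 by (intro mult_mono) auto
    also have "norm (2 * \<alpha> * u ^ 3) \<le> 2 * A * norm u ^ 2"
      unfolding norm_mult norm_power norm_numeral using A p A0 by (intro mult_mono) auto
    also have "norm (W * u ^ 4) \<le> K * norm u ^ 2"
      unfolding norm_mult norm_power using p A0 by (intro mult_mono) auto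
    also have "norm (\<xi> * u ^ 3 * s) \<le> norm \<xi> * norm u ^ 3 * 1"
      unfolding norm_mult norm_power using s1 by (intro mult_left_mono) auto
    finally show ?thesis by (simp add: algebra_simps)
  qed
  \<comment> \<open>The estimate for \<open>\<xi> ^ 2 - 1\<close> still contains \<xi>. If |\<xi>|
    exceeded 2, it would give |\<xi>|^2 \<le> 2 + |\<xi>| / 2, which is impossible; this a priori
    bound explains the summand 2 in \<open>C\<close>.\<close>
  have xi_le: "norm \<xi> \<le> 2"
  proof (rule ccontr)
    assume "\<not> norm \<xi> \<le> 2"
    then have g: "norm \<xi> > 2" by simp
    have "norm \<xi> * norm \<xi> = norm (\<xi> ^ 2)"
      by (simp add: norm_mult power2_eq_square)
    also have "\<dots> \<le> 1 + norm (\<xi> ^ 2 - 1)"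
      using norm_triangle_sub[of "\<xi> ^ 2" 1] by simp
    finally have 1: "norm \<xi> * norm \<xi> \<le> 1 + norm (\<xi> ^ 2 - 1)" .
    have "(3 * A + K) * norm u ^ 2 \<le> C * norm u ^ 2"
      unfolding C_def by (intro mult_right_mono) auto
    with Cu have 2: "(3 * A + K) * norm u ^ 2 \<le> 1" by linarith
    have "norm u ^ 3 \<le> (1/2) ^ 3" using u2 by (intro power_mono) auto
    then have "norm u ^ 3 \<le> 1 / 2" by (simp add: power3_eq_cube)
    then have 3: "norm \<xi> * norm u ^ 3 \<le> norm \<xi> * (1 / 2)"
      by (intro mult_left_mono) auto
    have "norm \<xi> * 2 \<le> norm \<xi> * norm \<xi>" using g by (intro mult_left_mono) auto
    with 1 2 3 n g show False by linarith
  qed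
  have nC: "norm (\<xi> ^ 2 - 1) \<le> C * norm u ^ 2"
  proof -
    have "norm \<xi> * norm u ^ 3 \<le> 2 * norm u ^ 2"
      using xi_le p by (intro mult_mono) auto
    with n show ?thesis by (simp add: C_def algebra_simps)
  qed
  \<comment> \<open>With this sign Re (\<epsilon> \<xi>) \<ge> 0, so the factor d + 2 in d (d + 2) =
    \<xi>^2 - 1 has norm at least 1, and d inherits the bound O(u^2).\<close>
  define \<epsilon> :: complex where "\<epsilon> = (if Re \<xi> \<ge> 0 then 1 else -1)"
  have e: "\<epsilon> = 1 \<or> \<epsilon> = -1" "\<epsilon> * \<epsilon> = 1" "norm \<epsilon> = 1" by (auto simp: \<epsilon>_def)
  define d where "d = \<epsilon> * \<xi> - 1"
  have "Re (d + 2) \<ge> 1" by (auto simp: d_def \<epsilon>_def)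
  then have d2: "norm (d + 2) \<ge> 1"
    using complex_Re_le_cmod order_trans by blast
  have dd: "d * (d + 2) = \<xi> ^ 2 - 1"
    using e(2) unfolding d_def by algebra
  have dC: "norm d \<le> C * norm u ^ 2"
  proof -
    have "norm d * 1 \<le> norm d * norm (d + 2)"
      using d2 by (intro mult_left_mono) auto
    also have "\<dots> = norm (\<xi> ^ 2 - 1)" by (metis dd norm_mult)
    finally show ?thesis using nC by simp
  qed
  define w where "w = (d - z * u ^ 2 / 2 - (\<alpha> - \<epsilon> / 2) * u ^ 3) / u ^ 4"
  have wu: "w * u ^ 4 = d - z * u ^ 2 / 2 - (\<alpha> - \<epsilon> / 2) * u ^ 3"
    using u0 by (simp add: w_def)
  have xi_d: "\<xi> = \<epsilon> * (1 + d)"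
    using e(2) unfolding d_def by algebra
  \<comment> \<open>Since 2 d = (\<xi>^2 - 1) - d^2, the terms in z and \<alpha> disappear. The
    remaining terms of order u^3 combine with factor 1 - s - d s, and 1 - s = |u|^2 s, so everything
    is O(u^4).\<close>
  have "2 * (w * u ^ 4) = 2 * d - z * u ^ 2 - 2 * \<alpha> * u ^ 3 + \<epsilon> * u ^ 3"
    unfolding wu by (simp add: algebra_simps)
  also have "\<dots> = W * u ^ 4 - d ^ 2 + \<epsilon> * u ^ 3 * (u * cnj u * s - d * s)"
    using dd unfolding xi2 unfolding xi_d su[symmetric] by algebra
  also have "norm \<dots> \<le> norm (W * u ^ 4) + norm (d ^ 2) + norm (\<epsilon> * u ^ 3 * (u * cnj u * s - d * s))"
    by norm
  also have "norm (W * u ^ 4) \<le> K * norm u ^ 4"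
    unfolding norm_mult norm_power using A0 by (intro mult_mono) auto
  also have "norm (d ^ 2) \<le> C\<^sup>2 * norm u ^ 4"
  proof -
    have "norm (d ^ 2) \<le> (C * norm u ^ 2) ^ 2"
      unfolding norm_power using dC by (intro power_mono) auto
    then show ?thesis by (simp add: power_mult_distrib flip: power_mult)
  qed
  also have "norm (\<epsilon> * u ^ 3 * (u * cnj u * s - d * s)) \<le> norm u ^ 3 * (norm u ^ 2 + C * norm u ^ 2)"
  proof -
    have "norm (u * cnj u * s - d * s) \<le> norm (u * cnj u) * norm s + norm d * norm s"
      by (metis norm_mult norm_triangle_ineq4)
    also have "\<dots> \<le> norm u ^ 2 * 1 + (C * norm u ^ 2) * 1"
      using s1 dC C0 by (intro add_mono mult_mono) (auto simp: norm_mult power2_eq_square)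
    finally show ?thesis
      unfolding norm_mult[of _ "u * cnj u * s - d * s"] norm_mult[of \<epsilon>] e(3) norm_power
      by (simp add: mult_left_mono)
  qed
  also have "norm u ^ 3 * (norm u ^ 2 + C * norm u ^ 2) = (1 + C) * norm u ^ 5"
    by (simp add: algebra_simps flip: power_add)
  also have "\<dots> \<le> (1 + C) * norm u ^ 4"
    using p C0 by (intro mult_left_mono) auto
  finally have "2 * (norm w * norm u ^ 4) \<le> (K + C\<^sup>2 + C + 1) * norm u ^ 4"
    by (simp add: norm_mult norm_power algebra_simps)
  then have "2 * norm w \<le> K + C\<^sup>2 + C + 1"
    using u0 by (simp flip: mult.assoc)
  then have "norm w \<le> K + C\<^sup>2 + C + 1"
    using norm_ge_zero[of w] by linarith
  moreover have "x = chart_x \<epsilon> \<alpha> z u w"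
  proof -
    have "x * u ^ 2 = \<epsilon> * (1 + z * u ^ 2 / 2 + (\<alpha> - \<epsilon> / 2) * u ^ 3 + w * u ^ 4)"
      using wu xi_d unfolding \<xi>_def by simp
    then show ?thesis
      unfolding chart_x_def using u0
      by (simp add: field_simps) (simp add: algebra_simps power2_eq_square power3_eq_cube power4_eq_xxxx)?
  qed
  ultimately show ?thesis
    using e(1) u0 u1 yu by blast
qed

text \<open>For fixed \<alpha>, the radius depends on the start only through \<open>A\<close> and
  \<open>K\<close>, so it cannot shrink along a segment on which \<open>lyapunov\<close> is bounded.
  The conclusion also records that the start is a regular point, where ODE uniqueness can be
  applied.\<close>

lemma uniform_local_meromorphic_solution:
  assumes \<alpha>: "norm \<alpha> \<le> A" and A: "A \<ge> 1"
  shows "\<exists>r>0. \<forall>z x y. norm z \<le> A \<longrightarrow> norm (lyapunov \<alpha> z x y) \<le> K \<longrightarrow>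
     (\<exists>X Y. X z = x \<and> Y z = y \<and> painleve_ode \<alpha> X Y z \<and> (\<forall>p\<in>ball z r. meromorphic_solution_at \<alpha> X Y p))"
proof -
  define C where "C = 3 * A + K + 2"
  \<comment> \<open>One box for all cases: the summands bound \<open>z\<close>, \<open>y\<close>
    below the threshold, \<open>x\<close> by way of |x| \<le> 1 + |x|^2, and the chart coordinate
    \<open>w\<close>. The norms keep every summand nonnegative although \<open>K\<close> is an
    arbitrary real.\<close>
  define B where "B = A + norm (2 + C) + (1 + (2 * norm K + 9 * A * (1 + (2 + C)\<^sup>2)\<^sup>2)) + norm (K + C\<^sup>2 + C + 1)"
  have B: "A \<le> B" "2 + C \<le> B" "1 + (2 * norm K + 9 * A * (1 + (2 + C)\<^sup>2)\<^sup>2) \<le> B" "K + C\<^sup>2 + C + 1 \<le> B" "1 \<le> B"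
  proof -
    have "0 \<le> 9 * A * (1 + (2 + C)\<^sup>2)\<^sup>2" using A by simp
    moreover have "0 \<le> norm (2 + C)" "2 + C \<le> norm (2 + C)" "0 \<le> norm K" "0 \<le> norm (K + C\<^sup>2 + C + 1)"
      "K + C\<^sup>2 + C + 1 \<le> norm (K + C\<^sup>2 + C + 1)"
      by simp_all
    ultimately show "A \<le> B" "2 + C \<le> B" "1 + (2 * norm K + 9 * A * (1 + (2 + C)\<^sup>2)\<^sup>2) \<le> B"
      "K + C\<^sup>2 + C + 1 \<le> B" "1 \<le> B"
      unfolding B_def using A by linarith+
  qed
  obtain r0 where r0: "r0 > 0" "\<And>z x y. norm z \<le> B \<Longrightarrow> norm x \<le> B \<Longrightarrow> norm y \<le> B \<Longrightarrow>
     \<exists>X Y. X z = x \<and> Y z = y \<and> (\<forall>p\<in>ball z r0. painleve_ode \<alpha> X Y p)"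
    using polynomial_field_local_solution[OF polynomial_field_painleve, of B \<alpha>]
    unfolding painleve_ode_def by blast
  have "\<exists>r>0. \<forall>z u w. norm z \<le> B \<longrightarrow> norm u \<le> B \<longrightarrow> norm w \<le> B \<longrightarrow>
     (\<exists>U V. U z = u \<and> V z = w \<and> (\<forall>p\<in>ball z r. (U has_field_derivative chart_field_u \<epsilon> \<alpha> p (U p) (V p)) (at p) \<and>
        (V has_field_derivative chart_field_w \<epsilon> \<alpha> p (U p) (V p)) (at p)))" for \<epsilon>
    by (rule polynomial_field_local_solution[OF polynomial_field_chart])
  then obtain rr where rr: "\<And>\<epsilon>. rr \<epsilon> > 0" "\<And>\<epsilon> z u w. norm z \<le> B \<Longrightarrow> norm u \<le> B \<Longrightarrow> norm w \<le> B \<Longrightarrow>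
     (\<exists>U V. U z = u \<and> V z = w \<and> (\<forall>p\<in>ball z (rr \<epsilon>). (U has_field_derivative chart_field_u \<epsilon> \<alpha> p (U p) (V p)) (at p) \<and>
        (V has_field_derivative chart_field_w \<epsilon> \<alpha> p (U p) (V p)) (at p)))"
    by metis
  define r where "r = min r0 (min (rr 1) (rr (-1)))"
  have r: "r > 0" "r \<le> r0" "r \<le> rr 1" "r \<le> rr (-1)"
    using r0(1) rr(1) by (auto simp: r_def)
  have "\<exists>X Y. X z = x \<and> Y z = y \<and> painleve_ode \<alpha> X Y z \<and> (\<forall>p\<in>ball z r. meromorphic_solution_at \<alpha> X Y p)"
    if z: "norm z \<le> A" and K: "norm (lyapunov \<alpha> z x y) \<le> K" for z x y
  proof (cases "norm y \<le> 2 + C")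
    case True
    have "K \<ge> 0" using K norm_ge_zero order_trans by blast
    have "(norm x)\<^sup>2 \<le> 2 * norm (lyapunov \<alpha> z x y) + 9 * A * (1 + (norm y)\<^sup>2)\<^sup>2"
      by (rule norm_square_le_lyapunov[OF A z \<alpha>])
    also have "\<dots> \<le> 2 * norm K + 9 * A * (1 + (2 + C)\<^sup>2)\<^sup>2"
      using True A K by (intro add_mono mult_left_mono power_mono) auto
    finally have "norm x \<le> B"
      using norm_le_one_plus_square[of x] B(3) by linarith
    moreover have "norm y \<le> B" "norm z \<le> B"
      using True B(1,2) z by linarith+
    ultimately obtain X Y where XY: "X z = x" "Y z = y" "\<And>p. p\<in>ball z r0 \<Longrightarrow> painleve_ode \<alpha> X Y p"
      using r0(2) by blast
    have "meromorphic_solution_at \<alpha> X Y p" if "p \<in> ball z r0" for p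
    proof -
      have "\<forall>\<^sub>F q in at p. q \<in> ball z r0"
        using that by (intro eventually_at_in_open') auto
      then have "\<forall>\<^sub>F q in at p. painleve_ode \<alpha> X Y q"
        by (rule eventually_mono) (rule XY(3))
      then show ?thesis
        unfolding meromorphic_solution_at_def using XY(3)[OF that] by blast
    qed
    then show ?thesis
      using XY r r0(1) by (intro exI[of _ X] exI[of _ Y]) auto
  next
    case False
    then obtain \<epsilon> u w where *: "\<epsilon> = 1 \<or> \<epsilon> = -1" "u \<noteq> 0" "y = 1 / u" "x = chart_x \<epsilon> \<alpha> z u w"
          "norm u \<le> 1" "norm w \<le> K + C\<^sup>2 + C + 1"
      using lyapunov_bounded_chart[OF z \<alpha> K, folded C_def] by auto
    have "norm z \<le> B" "norm u \<le> B" "norm w \<le> B"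
      using z * B by linarith+
    from rr(2)[OF this, of \<epsilon>] obtain U V where UV: "U z = u" "V z = w"
      "\<And>p. p \<in> ball z (rr \<epsilon>) \<Longrightarrow> (U has_field_derivative chart_field_u \<epsilon> \<alpha> p (U p) (V p)) (at p)"
      "\<And>p. p \<in> ball z (rr \<epsilon>) \<Longrightarrow> (V has_field_derivative chart_field_w \<epsilon> \<alpha> p (U p) (V p)) (at p)"
      by blast
    let ?X = "\<lambda>z. if U z = 0 then 0 else chart_x \<epsilon> \<alpha> z (U z) (V z)" and ?Y = "\<lambda>z. 1 / U z"
    have zb: "z \<in> ball z (rr \<epsilon>)" using rr(1) by simp
    have "painleve_ode \<alpha> ?X ?Y z"
      by (rule painleve_ode_chart[OF *(1) UV(3,4)[OF zb]]) (use UV *(2) in auto)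
    moreover have "meromorphic_solution_at \<alpha> ?X ?Y p" if "p \<in> ball z (rr \<epsilon>)" for p
      by (rule meromorphic_solution_at_chart[OF *(1) open_ball that UV(3,4)])
    moreover have "ball z r \<subseteq> ball z (rr \<epsilon>)"
      using r *(1) by auto
    ultimately show ?thesis
      using UV(1,2) * by (intro exI[of _ ?X] exI[of _ ?Y]) auto
  qed
  then show ?thesis
    using r(1) by blast
qed

section \<open>Continuation\<close>

lemma painleve_ode_cong:
  assumes ev: "\<forall>\<^sub>F q in nhds z. x q = x' q \<and> y q = y' q" and ode: "painleve_ode \<alpha> x y z"
  shows "painleve_ode \<alpha> x' y' z"
proof -
  have x: "\<forall>\<^sub>F q in nhds z. x q = x' q" and y: "\<forall>\<^sub>F q in nhds z. y q = y' q"
    using ev by (auto elim: eventually_mono)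
  show ?thesis
    using ode eventually_nhds_x_imp_x[OF ev] unfolding painleve_ode_def
    by (simp add: DERIV_cong_ev[OF refl x refl] DERIV_cong_ev[OF refl y refl])
qed

lemma meromorphic_solution_at_cong:
  assumes ev: "\<forall>\<^sub>F q in nhds p. x q = x' q \<and> y q = y' q" and sol: "meromorphic_solution_at \<alpha> x y p"
  shows "meromorphic_solution_at \<alpha> x' y' p"
proof -
  have ev_at: "\<forall>\<^sub>F q in at p. x q = x' q \<and> y q = y' q"
    using ev by (simp add: eventually_nhds_conv_at)
  have "\<forall>\<^sub>F z in at p. \<forall>\<^sub>F q in nhds z. x q = x' q \<and> y q = y' q"
    using ev by (subst (asm) eventually_eventually[symmetric]) (simp add: eventually_nhds_conv_at)
  then have "\<forall>\<^sub>F z in at p. painleve_ode \<alpha> x' y' z"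
    using sol unfolding meromorphic_solution_at_def
    by (auto elim: eventually_elim2 intro: painleve_ode_cong)
  moreover have "is_pole x' p" if "is_pole x p"
    using that by (rule is_pole_transform) (use ev_at in \<open>auto elim: eventually_mono\<close>)
  moreover have "is_pole y' p" if "is_pole y p"
    using that by (rule is_pole_transform) (use ev_at in \<open>auto elim: eventually_mono\<close>)
  ultimately show ?thesis
    using sol eventually_nhds_x_imp_x[OF ev] painleve_ode_cong[OF ev]
    unfolding meromorphic_solution_at_def by auto
qed

lemma painleve_ode_isCont:
  assumes "painleve_ode \<alpha> x y p" shows "isCont x p" "isCont y p"
  using assms DERIV_isCont unfolding painleve_ode_def by blast+

lemma painleve_ode_not_pole:
  assumes "painleve_ode \<alpha> x y p" shows "\<not> is_pole x p"
  using painleve_ode_isCont(1)[OF assms] not_tendsto_and_filterlim_at_infinity[of "at p" x "x p"]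
  unfolding is_pole_def isCont_def by auto

lemma meromorphic_solution_sparse_poles:
  assumes "open S" "\<And>p. p \<in> S \<Longrightarrow> meromorphic_solution_at \<alpha> x y p"
  shows "{p\<in>S. \<not> painleve_ode \<alpha> x y p} sparse_in S"
  unfolding sparse_in_eventually_iff[OF assms(1)]
proof
  fix p assume "p \<in> S"
  then have "\<forall>\<^sub>F z in at p. painleve_ode \<alpha> x y z"
    using assms(2) unfolding meromorphic_solution_at_def by blast
  then show "\<forall>\<^sub>F z in at p. z \<notin> {p\<in>S. \<not> painleve_ode \<alpha> x y p}"
    by (rule eventually_mono) blast
qed

text \<open>Removing the sparse singular sets of both solutions leaves a connected open set, where
  the identity theorem applies. Agreement near a removed point forces both solutions to be singular
  there or neither, and the value 0 at poles gives equality even at those points.\<close>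

lemma meromorphic_solution_unique:
  assumes S: "open S" "connected S"
    and sol: "\<And>p. p \<in> S \<Longrightarrow> meromorphic_solution_at \<alpha> x y p"
    and sol': "\<And>p. p \<in> S \<Longrightarrow> meromorphic_solution_at \<alpha> x' y' p"
    and z0: "z0 \<in> S" "\<forall>\<^sub>F z in nhds z0. x z = x' z \<and> y z = y' z" and "p \<in> S"
  shows "x p = x' p \<and> y p = y' p"
proof -
  define N where "N = {p\<in>S. \<not> painleve_ode \<alpha> x y p} \<union> {p\<in>S. \<not> painleve_ode \<alpha> x' y' p}"
  have N: "N sparse_in S"
    unfolding N_def using meromorphic_solution_sparse_poles[OF S(1)] sol sol' by (intro sparse_in_union') blast+
  have oS: "open (S - N)" using open_diff_sparse_pts[OF S(1) N] .
  have cS: "connected (S - N)" using sparse_imp_connected[OF _ S(2,1) N] by simp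
  have evN: "\<forall>\<^sub>F q in at p. q \<in> S - N" if "p \<in> S" for p
    using N[unfolded sparse_in_eventually_iff[OF S(1)]] eventually_at_in_open'[OF S(1) that] that
    by (auto elim: eventually_elim2)
  have hol: "x holomorphic_on S - N" "y holomorphic_on S - N" "x' holomorphic_on S - N" "y' holomorphic_on S - N"
    unfolding holomorphic_on_open[OF oS] by (auto simp: N_def painleve_ode_def)
  have "\<forall>\<^sub>F z in at z0. \<forall>\<^sub>F q in nhds z. x q = x' q \<and> y q = y' q"
    using z0(2) by (subst (asm) eventually_eventually[symmetric]) (simp add: eventually_nhds_conv_at)
  \<comment> \<open>\<open>z0\<close> may itself be a pole, so the base point is moved to a nearby
    regular point.\<close>
  from eventually_happens'[OF _ eventually_conj[OF this evN[OF z0(1)]]]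
  obtain z1 where z1: "\<forall>\<^sub>F q in nhds z1. x q = x' q \<and> y q = y' q" "z1 \<in> S - N"
    by auto
  then obtain T where T: "open T" "z1 \<in> T" "\<And>q. q \<in> T \<Longrightarrow> x q = x' q \<and> y q = y' q"
    unfolding eventually_nhds by blast
  have eqN: "x q = x' q \<and> y q = y' q" if "q \<in> S - N" for q
  proof -
    have o: "open (T \<inter> (S - N))" "T \<inter> (S - N) \<noteq> {}" using T oS z1 by auto
    show ?thesis
      using analytic_continuation_open[OF o(1) oS o(2) cS _ hol(1,3) _ that]
        analytic_continuation_open[OF o(1) oS o(2) cS _ hol(2,4) _ that] T(3) by auto
  qed
  have ev: "\<forall>\<^sub>F q in at p. x q = x' q"
    using evN[OF \<open>p \<in> S\<close>] by (rule eventually_mono) (use eqN in blast)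
  have "is_pole x p \<longleftrightarrow> is_pole x' p"
    using ev by (intro is_pole_cong) auto
  then show ?thesis
    using sol[OF \<open>p \<in> S\<close>] sol'[OF \<open>p \<in> S\<close>] eqN[of p] painleve_ode_not_pole \<open>p \<in> S\<close>
    unfolding meromorphic_solution_at_def N_def by auto
qed

text \<open>
  Each point other than \<open>a\<close> lies on at most one of the lines through \<open>a\<close> and \<open>z0 + i s (a - z0)\<close>, \<open>0 < s < 1\<close>,
  and \<open>\<sigma>\<close> recovers \<open>s\<close> from such a point.
\<close>

lemma generic_segment:
  fixes z0 a :: complex
  assumes N: "countable N" and R: "R > 0" and a: "dist z0 a = R"
  obtains z1 where "\<And>t. t \<in> {0..<1::real} \<Longrightarrow> z1 + of_real t * (a - z1) \<in> ball z0 R - N"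
proof -
  define \<sigma> where "\<sigma> p = - Im ((p - a) / (z0 - a)) / Re ((p - a) / (z0 - a))" for p
  have "uncountable ({0<..<1::real} - \<sigma> ` N)"
    using N by (intro uncountable_minus_countable) (auto simp: uncountable_open_interval)
  then have "{0<..<1::real} - \<sigma> ` N \<noteq> {}"
    by (metis countable_empty)
  then obtain s where "s \<in> {0<..<1::real} - \<sigma> ` N"
    by blast
  then have s: "0 < s" "s < 1" "s \<notin> \<sigma> ` N"
    by auto
  have ne: "z0 - a \<noteq> 0" using R a by auto
  have na: "norm (a - z0) = R" using a by (simp add: dist_norm norm_minus_commute)
  define z1 where "z1 = z0 + of_real s * \<i> * (a - z0)"
  show thesis
  proof (rule that[of z1])
    fix t :: real assume t: "t \<in> {0..<1}"
    let ?g = "z1 + of_real t * (a - z1)"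
    have "?g - a = (z0 - a) * (of_real (1 - t) * (1 - \<i> * of_real s))"
      by (simp add: z1_def algebra_simps)
    then have "(?g - a) / (z0 - a) = of_real (1 - t) * (1 - \<i> * of_real s)"
      using ne by simp
    then have "\<sigma> ?g = s"
      using t by (simp add: \<sigma>_def)
    then have "?g \<notin> N" using s(3) by auto
    \<comment> \<open>The factor of a - z0 has norm at most (1 - t) s + t, which is below 1 because
      s < 1 and t < 1; the segment stays in the open ball until its end.\<close>
    have "?g - z0 = (of_real ((1 - t) * s) * \<i> + of_real t) * (a - z0)"
      by (simp add: z1_def algebra_simps)
    then have "norm (?g - z0) = norm (of_real ((1 - t) * s) * \<i> + of_real t :: complex) * R"
      using na by (simp only: norm_mult)
    also have "\<dots> \<le> ((1 - t) * s + t) * R"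
    proof (rule mult_right_mono)
      have "norm (of_real ((1 - t) * s) * \<i> + of_real t :: complex) \<le> norm (of_real ((1 - t) * s) * \<i> :: complex) + norm (of_real t :: complex)"
        by (rule norm_triangle_ineq)
      also have "\<dots> = (1 - t) * s + t"
        unfolding norm_mult norm_of_real using s t by (simp add: abs_mult)
      finally show "norm (of_real ((1 - t) * s) * \<i> + of_real t :: complex) \<le> (1 - t) * s + t" .
    qed (use R in simp)
    also have "\<dots> < 1 * R"
    proof (rule mult_strict_right_mono)
      have "(1 - t) * s < (1 - t) * 1" using t s by (intro mult_strict_left_mono) auto
      then show "(1 - t) * s + t < 1" by simp
    qed (rule R)
    finally have "?g \<in> ball z0 R"
      by (simp add: dist_norm norm_minus_commute)
    with \<open>?g \<notin> N\<close> show "?g \<in> ball z0 R - N" by blast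
  qed
qed

section \<open>Continuation across a boundary point\<close>

lemma painleve_ode_eventually:
  assumes "meromorphic_solution_at \<alpha> x y p" "painleve_ode \<alpha> x y p"
  shows "\<forall>\<^sub>F z in nhds p. painleve_ode \<alpha> x y z"
  using assms unfolding meromorphic_solution_at_def by (simp add: eventually_nhds_conv_at)

text \<open>The bound on \<open>lyapunov\<close> holds on the whole half-open segment, so the
  uniform radius \<open>r\<close> is known before a start on it is chosen. Starting close enough to
  \<open>a\<close>, the disc of the local solution contains \<open>a\<close>.\<close>

lemma extend_to_boundary_point:
  assumes R: "R > 0" and sol: "\<And>p. p \<in> ball z0 R \<Longrightarrow> meromorphic_solution_at \<alpha> x y p" and a: "dist z0 a = R"
  shows "\<exists>r>0. \<exists>X Y. (\<forall>p\<in>ball a r. meromorphic_solution_at \<alpha> X Y p) \<and> (\<forall>p\<in>ball a r \<inter> ball z0 R. X p = x p \<and> Y p = y p)"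
proof -
  define N where "N = {p\<in>ball z0 R. \<not> painleve_ode \<alpha> x y p}"
  have "countable (ball z0 R \<inter> N)"
    unfolding N_def by (intro sparse_imp_countable meromorphic_solution_sparse_poles sol) auto
  then obtain z1 where z1: "\<And>t. t \<in> {0..<1::real} \<Longrightarrow> z1 + of_real t * (a - z1) \<in> ball z0 R - (ball z0 R \<inter> N)"
    using generic_segment[OF _ R a] by blast
  define v where "v = a - z1"
  define \<gamma> where "\<gamma> t = z1 + of_real t * v" for t
  have \<gamma>: "\<gamma> t \<in> ball z0 R" "painleve_ode \<alpha> x y (\<gamma> t)" if "t \<in> {0..<1}" for t
    using z1[OF that] by (auto simp: \<gamma>_def N_def v_def)
  define A where "A = 1 + norm z0 + R + norm \<alpha> + norm v"
  have A: "A \<ge> 1" "norm \<alpha> \<le> A" "norm v \<le> A"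
    using R by (auto simp: A_def)
  have A\<gamma>: "norm (\<gamma> t) \<le> A" if "t \<in> {0..<1}" for t
  proof -
    have "norm (\<gamma> t) \<le> norm z0 + dist z0 (\<gamma> t)"
      unfolding dist_norm norm_minus_commute[of z0] by (rule norm_triangle_sub)
    then show ?thesis
      using \<gamma>(1)[OF that] norm_ge_zero[of \<alpha>] norm_ge_zero[of v] unfolding A_def mem_ball by linarith
  qed
  have d\<gamma>: "(\<gamma> has_vector_derivative v) (at t)" for t
    unfolding \<gamma>_def[abs_def] by (auto intro!: derivative_eq_intros)
  have "\<exists>K. \<forall>t\<in>{0..<1}. norm (lyapunov \<alpha> (\<gamma> t) (x (\<gamma> t)) (y (\<gamma> t))) \<le> K"
  proof (rule Gronwall_bounded)
    fix t :: real assume t: "t \<in> {0..<1}"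
    show "((\<lambda>t. lyapunov \<alpha> (\<gamma> t) (x (\<gamma> t)) (y (\<gamma> t))) has_vector_derivative
       (\<lambda>t. v * (- (y (\<gamma> t) ^ 2) + (2 * y (\<gamma> t) ^ 3 + y (\<gamma> t) * \<gamma> t + \<alpha>) * (cnj (y (\<gamma> t)) / (1 + y (\<gamma> t) * cnj (y (\<gamma> t))))
          - (cnj (y (\<gamma> t)) / (1 + y (\<gamma> t) * cnj (y (\<gamma> t)))) ^ 2 * x (\<gamma> t) ^ 2)
        + x (\<gamma> t) * cnj (v * x (\<gamma> t)) / (1 + y (\<gamma> t) * cnj (y (\<gamma> t))) ^ 2) t) (at t)"
      using lyapunov_has_vector_derivative[OF d\<gamma>] \<gamma>(2)[OF t] unfolding painleve_ode_def by blast
    show "norm ((\<lambda>t. v * (- (y (\<gamma> t) ^ 2) + (2 * y (\<gamma> t) ^ 3 + y (\<gamma> t) * \<gamma> t + \<alpha>) * (cnj (y (\<gamma> t)) / (1 + y (\<gamma> t) * cnj (y (\<gamma> t))))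
          - (cnj (y (\<gamma> t)) / (1 + y (\<gamma> t) * cnj (y (\<gamma> t)))) ^ 2 * x (\<gamma> t) ^ 2)
        + x (\<gamma> t) * cnj (v * x (\<gamma> t)) / (1 + y (\<gamma> t) * cnj (y (\<gamma> t))) ^ 2) t)
       \<le> 25 * A\<^sup>2 * (1 + norm (lyapunov \<alpha> (\<gamma> t) (x (\<gamma> t)) (y (\<gamma> t))))"
      using lyapunov_derivative_bound[OF A(1) A\<gamma>[OF t] A(2,3)] .
  qed simp
  then obtain K where K: "\<And>t. t \<in> {0..<1} \<Longrightarrow> norm (lyapunov \<alpha> (\<gamma> t) (x (\<gamma> t)) (y (\<gamma> t))) \<le> K"
    by blast
  obtain r where r: "r > 0" "\<And>z x y. norm z \<le> A \<Longrightarrow> norm (lyapunov \<alpha> z x y) \<le> K \<Longrightarrow>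
     (\<exists>X Y. X z = x \<and> Y z = y \<and> painleve_ode \<alpha> X Y z \<and> (\<forall>p\<in>ball z r. meromorphic_solution_at \<alpha> X Y p))"
    using uniform_local_meromorphic_solution[OF A(2,1), of K] by blast
  \<comment> \<open>The remaining distance to \<open>a\<close> is (1 - t) |v|, so this choice makes
    it smaller than \<open>r\<close>. Adding 1 to \<open>norm v\<close> makes the inequality strict,
    and the minimum keeps t \<ge> 0.\<close>
  define t where "t = 1 - min 1 (r / (norm v + 1))"
  have t: "t \<in> {0..<1}"
    using r(1) by (auto simp: t_def add_nonneg_pos)
  have "dist (\<gamma> t) a = (1 - t) * norm v"
  proof -
    have "a - \<gamma> t = of_real (1 - t) * v" by (simp add: \<gamma>_def v_def algebra_simps)
    then have "norm (a - \<gamma> t) = \<bar>1 - t\<bar> * norm v"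
      by (simp only: norm_mult norm_of_real)
    then show ?thesis using t by (simp add: dist_norm norm_minus_commute)
  qed
  also have "\<dots> \<le> (r / (norm v + 1)) * norm v"
    by (intro mult_right_mono) (auto simp: t_def)
  also have "\<dots> = r * (norm v / (norm v + 1))"
    by simp
  also have "\<dots> < r * 1"
    using r(1) by (intro mult_strict_left_mono) (auto simp: divide_less_eq add_nonneg_pos)
  finally have da: "dist (\<gamma> t) a < r" by simp
  obtain X Y where XY: "X (\<gamma> t) = x (\<gamma> t)" "Y (\<gamma> t) = y (\<gamma> t)" "painleve_ode \<alpha> X Y (\<gamma> t)"
    "\<And>p. p\<in>ball (\<gamma> t) r \<Longrightarrow> meromorphic_solution_at \<alpha> X Y p"
    using r(2)[OF A\<gamma>[OF t] K[OF t]] by blast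
  have gb: "\<gamma> t \<in> ball (\<gamma> t) r" using r(1) by simp
  \<comment> \<open>Equal values at a regular point give equality near it by ODE uniqueness;
    \<open>meromorphic_solution_unique\<close> then spreads it over the overlap of the two
    discs.\<close>
  have ev: "\<forall>\<^sub>F q in nhds (\<gamma> t). X q = x q \<and> Y q = y q"
    by (rule polynomial_field_unique[OF polynomial_field_painleve(1)[of \<alpha>] polynomial_field_painleve(2)])
       (use painleve_ode_eventually[OF XY(4)[OF gb] XY(3)] painleve_ode_eventually[OF sol[OF \<gamma>(1)[OF t]] \<gamma>(2)[OF t]] XY(1,2)
          in \<open>simp_all add: painleve_ode_def\<close>)
  have eq: "X p = x p \<and> Y p = y p" if "p \<in> ball (\<gamma> t) r \<inter> ball z0 R" for p
    by (rule meromorphic_solution_unique[where S = "ball (\<gamma> t) r \<inter> ball z0 R" and ?z0.0 = "\<gamma> t" and \<alpha> = \<alpha>])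
       (use XY sol ev that \<gamma>(1)[OF t] r(1) in \<open>auto intro!: convex_connected convex_Int\<close>)
  have sub: "ball a (r - dist (\<gamma> t) a) \<subseteq> ball (\<gamma> t) r"
  proof
    fix q assume "q \<in> ball a (r - dist (\<gamma> t) a)"
    then show "q \<in> ball (\<gamma> t) r"
      using dist_triangle[of "\<gamma> t" q a] by simp
  qed
  have "r - dist (\<gamma> t) a > 0" using da by simp
  moreover have "\<forall>p\<in>ball a (r - dist (\<gamma> t) a). meromorphic_solution_at \<alpha> X Y p"
    using sub XY(4) by blast
  moreover have "\<forall>p\<in>ball a (r - dist (\<gamma> t) a) \<inter> ball z0 R. X p = x p \<and> Y p = y p"
    using sub eq by blast
  ultimately show ?thesis
    by blast
qed

section \<open>Gluing solutions and enlarging a disc\<close>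

lemma glue_meromorphic_solutions:
  assumes D: "\<And>i. i \<in> I \<Longrightarrow> open (D i)"
    and sol: "\<And>i p. i \<in> I \<Longrightarrow> p \<in> D i \<Longrightarrow> meromorphic_solution_at \<alpha> (x i) (y i) p"
    and agree: "\<And>i j p. i \<in> I \<Longrightarrow> j \<in> I \<Longrightarrow> p \<in> D i \<Longrightarrow> p \<in> D j \<Longrightarrow> x i p = x j p \<and> y i p = y j p"
  obtains X Y where "\<And>p. p \<in> (\<Union>i\<in>I. D i) \<Longrightarrow> meromorphic_solution_at \<alpha> X Y p"
    "\<And>i p. i \<in> I \<Longrightarrow> p \<in> D i \<Longrightarrow> X p = x i p \<and> Y p = y i p"
proof -
  define k where "k p = (SOME i. i \<in> I \<and> p \<in> D i)" for p
  have k: "k p \<in> I \<and> p \<in> D (k p)" if "i \<in> I" "p \<in> D i" for i p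
    unfolding k_def by (rule someI[of _ i]) (use that in auto)
  define X Y where "X p = x (k p) p" and "Y p = y (k p) p" for p
  have eq: "X p = x i p \<and> Y p = y i p" if "i \<in> I" "p \<in> D i" for i p
    unfolding X_def Y_def using agree k[OF that] that by blast
  show thesis
  proof (rule that[of X Y])
    fix p assume "p \<in> (\<Union>i\<in>I. D i)"
    then obtain i where i: "i \<in> I" "p \<in> D i" by blast
    have "\<forall>\<^sub>F q in nhds p. q \<in> D i"
      using D[OF i(1)] i(2) by (rule eventually_nhds_in_open)
    then have "\<forall>\<^sub>F q in nhds p. x i q = X q \<and> y i q = Y q"
      by (rule eventually_mono) (use eq[OF i(1)] in auto)
    then show "meromorphic_solution_at \<alpha> X Y p"
      using sol[OF i] by (rule meromorphic_solution_at_cong)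
  qed (rule eq)
qed

lemma extend_beyond_ball:
  assumes R: "R > 0" and sol: "\<And>p. p \<in> ball z0 R \<Longrightarrow> meromorphic_solution_at \<alpha> x y p"
  shows "\<exists>R'>R. \<exists>X Y. (\<forall>p\<in>ball z0 R'. meromorphic_solution_at \<alpha> X Y p) \<and> (\<forall>p\<in>ball z0 R. X p = x p \<and> Y p = y p)"
proof -
  have "\<exists>r X Y. r > 0 \<and> (\<forall>p\<in>ball a r. meromorphic_solution_at \<alpha> X Y p) \<and> (\<forall>p\<in>ball a r \<inter> ball z0 R. X p = x p \<and> Y p = y p)"
    if "a \<in> sphere z0 R" for a
    using extend_to_boundary_point[OF R sol] that unfolding mem_sphere by blast
  then obtain r X Y where r: "\<And>a. a \<in> sphere z0 R \<Longrightarrow> r a > 0"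
    "\<And>a p. a \<in> sphere z0 R \<Longrightarrow> p \<in> ball a (r a) \<Longrightarrow> meromorphic_solution_at \<alpha> (X a) (Y a) p"
    "\<And>a p. a \<in> sphere z0 R \<Longrightarrow> p \<in> ball a (r a) \<Longrightarrow> p \<in> ball z0 R \<Longrightarrow> X a p = x p \<and> Y a p = y p"
    by (metis IntI)
  \<comment> \<open>If the balls around \<open>a\<close> and \<open>b\<close> meet, they share a point of the chord, which lies inside \<open>ball z0 R\<close>.\<close>
  have agree: "X a p = X b p \<and> Y a p = Y b p"
    if a: "a \<in> sphere z0 R" and b: "b \<in> sphere z0 R" and p: "p \<in> ball a (r a)" "p \<in> ball b (r b)" for a b p
  proof (cases "a = b")
    case False
    define s where "s = r a + r b"
    have s: "s > 0" "dist a b < s"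
      using r(1)[OF a] r(1)[OF b] p dist_triangle2[of a b p] by (auto simp: s_def dist_commute)
    \<comment> \<open>\<open>m\<close> divides the chord in the ratio \<open>r a\<close> to
      \<open>r b\<close>. As |a - b| < r a + r b, it lies in both discs.\<close>
    define m where "m = (1 - r a / s) *\<^sub>R a + (r a / s) *\<^sub>R b"
    have u: "0 < r a / s" "r a / s < 1"
      using r(1)[OF a] r(1)[OF b] s by (auto simp: s_def divide_less_eq)
    then have seg: "m \<in> open_segment a b"
      unfolding m_def in_segment using False by auto
    then have mR: "m \<in> ball z0 R"
      using dist_decreases_open_segment[OF seg, of z0] a b by auto
    have "m - a = (r a / s) *\<^sub>R (b - a)" by (simp add: m_def algebra_simps)
    then have "dist a m = r a * (dist a b / s)"
      using r(1)[OF a] s(1) by (simp add: dist_norm norm_minus_commute[of a])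
    also have "\<dots> < r a * 1"
      using r(1)[OF a] s by (intro mult_strict_left_mono) (auto simp: divide_less_eq)
    finally have ma: "m \<in> ball a (r a)" by simp
    have "m - b = (1 - r a / s) *\<^sub>R (a - b)" by (simp add: m_def algebra_simps)
    then have "dist b m = (1 - r a / s) * dist a b"
      using u by (simp add: dist_norm norm_minus_commute[of b m])
    also have "1 - r a / s = r b / s" using s(1) by (simp add: s_def field_simps)
    also have "r b / s * dist a b = r b * (dist a b / s)" by simp
    also have "\<dots> < r b * 1"
      using r(1)[OF b] s by (intro mult_strict_left_mono) (auto simp: divide_less_eq)
    finally have mb: "m \<in> ball b (r b)" by simp
    have "\<forall>\<^sub>F q in nhds m. q \<in> ball z0 R \<inter> ball a (r a) \<inter> ball b (r b)"
      using mR ma mb by (intro eventually_nhds_in_open) auto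
    then have ev: "\<forall>\<^sub>F q in nhds m. X a q = X b q \<and> Y a q = Y b q"
      by (rule eventually_mono) (use r(3)[OF a] r(3)[OF b] in auto)
    show ?thesis
      by (rule meromorphic_solution_unique[where S = "ball a (r a) \<inter> ball b (r b)" and ?z0.0 = m and \<alpha> = \<alpha>])
         (use ev ma mb p r(2)[OF a] r(2)[OF b] in \<open>auto intro!: convex_connected convex_Int\<close>)
  qed simp
  \<comment> \<open>The centre \<open>z0\<close> is not on the sphere, so it can serve as the index
    of the original disc.\<close>
  define I where "I = insert z0 (sphere z0 R)"
  define D where "D a = (if a = z0 then ball z0 R else ball a (r a))" for a
  have z0: "z0 \<notin> sphere z0 R" using R by simp
  obtain X' Y' where X': "\<And>p. p \<in> (\<Union>i\<in>I. D i) \<Longrightarrow> meromorphic_solution_at \<alpha> X' Y' p"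
    "\<And>i p. i \<in> I \<Longrightarrow> p \<in> D i \<Longrightarrow> X' p = (if i = z0 then x else X i) p \<and> Y' p = (if i = z0 then y else Y i) p"
  proof (rule glue_meromorphic_solutions[of I D \<alpha> "\<lambda>i. if i = z0 then x else X i" "\<lambda>i. if i = z0 then y else Y i"])
    show "open (D i)" for i by (simp add: D_def)
    show "meromorphic_solution_at \<alpha> (if i = z0 then x else X i) (if i = z0 then y else Y i) p"
      if "i \<in> I" "p \<in> D i" for i p
      using that sol r(2)[of i p] by (cases "i = z0") (simp_all add: I_def D_def)
    show "(if i = z0 then x else X i) p = (if j = z0 then x else X j) p \<and> (if i = z0 then y else Y i) p = (if j = z0 then y else Y j) p"
      if "i \<in> I" "j \<in> I" "p \<in> D i" "p \<in> D j" for i j p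
      using that r(3)[of i p] r(3)[of j p] agree[of i j p]
      by (cases "i = z0"; cases "j = z0") (simp_all add: I_def D_def)
  qed blast
  have "cball z0 R \<subseteq> (\<Union>i\<in>I. D i)"
  proof
    fix p assume "p \<in> cball z0 R"
    then consider "p \<in> ball z0 R" | "p \<in> sphere z0 R" by force
    then show "p \<in> (\<Union>i\<in>I. D i)"
    proof cases
      case 1
      then show ?thesis by (intro UN_I[of z0]) (auto simp: I_def D_def)
    next
      case 2
      then have "p \<noteq> z0" using z0 by blast
      with 2 r(1)[OF 2] show ?thesis by (intro UN_I[of p]) (auto simp: I_def D_def)
    qed
  qed
  moreover have "open (\<Union>i\<in>I. D i)"
    by (auto simp: D_def)
  ultimately obtain e where e: "e > 0" "(\<Union>p\<in>cball z0 R. ball p e) \<subseteq> (\<Union>i\<in>I. D i)"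
    using compact_subset_open_imp_ball_epsilon_subset[OF compact_cball] by blast
  have "ball z0 (R + e) \<subseteq> (\<Union>p\<in>cball z0 R. ball p e)"
  proof
    fix q assume q: "q \<in> ball z0 (R + e)"
    show "q \<in> (\<Union>p\<in>cball z0 R. ball p e)"
    proof (cases "q \<in> cball z0 R")
      case True
      then show ?thesis using e(1) by (intro UN_I[of q]) auto
    next
      case False
      define d where "d = dist z0 q"
      have d: "R < d" "d < R + e" using q False by (auto simp: d_def)
      have "q \<noteq> z0" using d R by (auto simp: d_def)
      \<comment> \<open>The radial projection of \<open>q\<close> to the sphere, at distance d - R <
        e from \<open>q\<close>.\<close>
      define p where "p = z0 + (R / d) *\<^sub>R (q - z0)"
      have pR: "norm (p - z0) = R"
        using d R \<open>q \<noteq> z0\<close> by (simp add: p_def d_def dist_norm norm_minus_commute)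
      have "q - p = (1 - R / d) *\<^sub>R (q - z0)"
        by (simp add: p_def algebra_simps)
      then have "norm (q - p) = (1 - R / d) * d"
        using d R \<open>q \<noteq> z0\<close> by (simp add: d_def dist_norm norm_minus_commute)
      moreover have "(1 - R / d) * d = d - R"
        using d R by (simp add: field_simps)
      ultimately have "norm (q - p) = d - R" by simp
      then show ?thesis
        using d pR by (intro UN_I[of p]) (auto simp: dist_norm norm_minus_commute)
    qed
  qed
  then have "\<forall>p\<in>ball z0 (R + e). meromorphic_solution_at \<alpha> X' Y' p"
    using X'(1) e(2) by blast
  moreover have "\<forall>p\<in>ball z0 R. X' p = x p \<and> Y' p = y p"
    using X'(2)[of z0] by (auto simp: I_def D_def)
  ultimately show ?thesis
    using e(1) by (intro exI[of _ "R + e"]) auto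
qed

text \<open>Solutions on different discs about \<open>z0\<close> all extend the given one, so they
  agree on the smaller disc and glue. If the radii had a finite supremum, the glued solution on that
  disc could be enlarged.\<close>

theorem global_meromorphic_solution:
  assumes \<rho>: "\<rho> > 0" and sol: "\<And>p. p \<in> ball z0 \<rho> \<Longrightarrow> meromorphic_solution_at \<alpha> x y p"
  obtains X Y where "\<And>p. meromorphic_solution_at \<alpha> X Y p" "\<And>p. p \<in> ball z0 \<rho> \<Longrightarrow> X p = x p \<and> Y p = y p"
proof -
  define E where "E = {R. \<rho> \<le> R \<and> (\<exists>X Y. (\<forall>p\<in>ball z0 R. meromorphic_solution_at \<alpha> X Y p) \<and> (\<forall>p\<in>ball z0 \<rho>. X p = x p \<and> Y p = y p))}"
  have "\<rho> \<in> E" unfolding E_def using sol by blast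
  have "\<exists>X Y. (\<forall>p\<in>ball z0 R. meromorphic_solution_at \<alpha> X Y p) \<and> (\<forall>p\<in>ball z0 \<rho>. X p = x p \<and> Y p = y p)" if "R \<in> E" for R
    using that by (simp add: E_def)
  then obtain X Y where XY: "\<And>R p. R \<in> E \<Longrightarrow> p \<in> ball z0 R \<Longrightarrow> meromorphic_solution_at \<alpha> (X R) (Y R) p"
    "\<And>R p. R \<in> E \<Longrightarrow> p \<in> ball z0 \<rho> \<Longrightarrow> X R p = x p \<and> Y R p = y p"
    by metis
  have ge: "\<rho> \<le> R" if "R \<in> E" for R using that by (simp add: E_def)
  have agree: "X R p = X R' p \<and> Y R p = Y R' p"
    if "R \<in> E" "R' \<in> E" "p \<in> ball z0 R" "p \<in> ball z0 R'" for R R' p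
  proof -
    have "\<forall>\<^sub>F q in nhds z0. q \<in> ball z0 \<rho>"
      using \<rho> by (intro eventually_nhds_in_open) auto
    then have "\<forall>\<^sub>F q in nhds z0. X R q = X R' q \<and> Y R q = Y R' q"
      by (rule eventually_mono) (use XY(2) that in auto)
    then show ?thesis
      by (intro meromorphic_solution_unique[where S = "ball z0 R \<inter> ball z0 R'" and ?z0.0 = z0 and \<alpha> = \<alpha>])
         (use XY(1) that ge[OF that(1)] ge[OF that(2)] \<rho> in \<open>auto intro!: convex_connected convex_Int\<close>)
  qed
  obtain X' Y' where X': "\<And>p. p \<in> (\<Union>R\<in>E. ball z0 R) \<Longrightarrow> meromorphic_solution_at \<alpha> X' Y' p"
    "\<And>R p. R \<in> E \<Longrightarrow> p \<in> ball z0 R \<Longrightarrow> X' p = X R p \<and> Y' p = Y R p"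
  proof (rule glue_meromorphic_solutions[of E "ball z0" \<alpha> X Y, OF open_ball XY(1) agree], goal_cases)
    case (7 X' Y')
    show ?case by (rule 7(1)[OF 7(2,3)])
  qed
  have X'x: "X' p = x p \<and> Y' p = y p" if "p \<in> ball z0 \<rho>" for p
    using X'(2)[OF \<open>\<rho> \<in> E\<close> that] XY(2)[OF \<open>\<rho> \<in> E\<close> that] by simp
  have "\<not> bdd_above E"
  proof
    assume bdd: "bdd_above E"
    define M where "M = Sup E"
    have "\<rho> \<le> M" unfolding M_def using \<open>\<rho> \<in> E\<close> bdd by (rule cSup_upper)
    \<comment> \<open>The supremum is not known to belong to \<open>E\<close>; each point of the
      open disc is instead covered by a smaller admissible disc.\<close>
    have "p \<in> (\<Union>R\<in>E. ball z0 R)" if "p \<in> ball z0 M" for p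
      using that less_cSup_iff[OF _ bdd, of "dist z0 p"] \<open>\<rho> \<in> E\<close> by (auto simp: M_def)
    then have "\<And>p. p \<in> ball z0 M \<Longrightarrow> meromorphic_solution_at \<alpha> X' Y' p"
      by (rule X'(1))
    moreover have "M > 0" using \<rho> \<open>\<rho> \<le> M\<close> by linarith
    ultimately obtain R' X2 Y2 where R': "R' > M"
      "\<forall>p\<in>ball z0 R'. meromorphic_solution_at \<alpha> X2 Y2 p" "\<forall>p\<in>ball z0 M. X2 p = X' p \<and> Y2 p = Y' p"
      using extend_beyond_ball[of M z0 \<alpha> X' Y'] by blast
    have "X2 p = x p \<and> Y2 p = y p" if "p \<in> ball z0 \<rho>" for p
      using X'x[OF that] bspec[OF R'(3), of p] that \<open>\<rho> \<le> M\<close> by simp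
    moreover have "\<rho> \<le> R'" using R'(1) \<open>\<rho> \<le> M\<close> by linarith
    ultimately have "R' \<in> E"
      unfolding E_def using R'(2) by blast
    then have "R' \<le> M" unfolding M_def using bdd by (rule cSup_upper)
    with R'(1) show False by simp
  qed
  then have "p \<in> (\<Union>R\<in>E. ball z0 R)" for p
    by (metis UN_I bdd_aboveI mem_ball not_le)
  then have "meromorphic_solution_at \<alpha> X' Y' p" for p
    by (rule X'(1))
  then show thesis
    using X'x by (rule that)
qed

section \<open>Meromorphy on the plane and agreement on the original domain\<close>

lemma meromorphic_solution_nicely_meromorphic:
  assumes sol: "\<And>p. meromorphic_solution_at \<alpha> x y p"
  shows "x nicely_meromorphic_on UNIV" "y nicely_meromorphic_on UNIV"
proof -
  define N where "N = {p. \<not> painleve_ode \<alpha> x y p}"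
  have "N sparse_in UNIV"
    using meromorphic_solution_sparse_poles[of UNIV \<alpha> x y] sol by (simp add: N_def)
  then have o: "open (UNIV - N)"
    by (intro open_diff_sparse_pts) auto
  have hol: "x holomorphic_on UNIV - N" "y holomorphic_on UNIV - N"
    unfolding holomorphic_on_open[OF o] by (auto simp: N_def painleve_ode_def)
  have iso: "isolated_singularity_at f p" if "f holomorphic_on UNIV - N" for f p
  proof -
    have "\<forall>\<^sub>F q in at p. q \<in> UNIV - N"
      using sol[of p] unfolding meromorphic_solution_at_def N_def by simp
    then obtain e where e: "e > 0" "\<And>q. q \<noteq> p \<Longrightarrow> dist q p < e \<Longrightarrow> q \<in> UNIV - N"
      unfolding eventually_at by blast
    then have "ball p e - {p} \<subseteq> UNIV - N"
      by (auto simp: dist_commute)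
    then have "f analytic_on ball p e - {p}"
      using that holomorphic_on_subset by (auto simp: analytic_on_open open_Diff)
    then show ?thesis
      unfolding isolated_singularity_at_def using e(1) by blast
  qed
  have pole: "is_pole x p \<and> x p = 0" "is_pole y p \<and> y p = 0" if "p \<in> N" for p
    using sol[of p] that unfolding meromorphic_solution_at_def N_def by auto
  show "x nicely_meromorphic_on UNIV"
    by (rule nicely_meromorphic_onI_open[where pts = N]) (use hol pole iso o in \<open>auto simp: analytic_on_open\<close>)
  show "y nicely_meromorphic_on UNIV"
    by (rule nicely_meromorphic_onI_open[where pts = N]) (use hol pole iso o in \<open>auto simp: analytic_on_open\<close>)
qed

theorem theorem3p5:
  fixes \<alpha> z0 x0 y0 :: complex
    and x y :: "complex \<Rightarrow> complex"
    and U :: "complex set"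
  assumes "open U" and "connected U" and "z0 \<in> U"
    and "painleve_II_solution_on \<alpha> x y U"
    and "x z0 = x0" and "y z0 = y0"
  shows "\<exists>X Y. X nicely_meromorphic_on UNIV \<and> Y nicely_meromorphic_on UNIV \<and>
           (\<forall>z\<in>U. X z = x z \<and> Y z = y z)"
proof -
  have ode: "painleve_ode \<alpha> x y p" if "p \<in> U" for p
    using assms(4) that unfolding painleve_II_solution_on_def painleve_ode_def by blast
  have sol: "meromorphic_solution_at \<alpha> x y p" if "p \<in> U" for p
    unfolding meromorphic_solution_at_def
    using eventually_at_in_open'[OF assms(1) that] ode that by (auto elim: eventually_mono)
  obtain \<rho> where \<rho>: "\<rho> > 0" "ball z0 \<rho> \<subseteq> U"
    using assms(1,3) openE by blast
  obtain X Y where XY: "\<And>p. meromorphic_solution_at \<alpha> X Y p" "\<And>p. p \<in> ball z0 \<rho> \<Longrightarrow> X p = x p \<and> Y p = y p"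
    by (rule global_meromorphic_solution[OF \<rho>(1), of z0 \<alpha> x y]) (use sol \<rho>(2) in auto)
  have "\<forall>\<^sub>F q in nhds z0. q \<in> ball z0 \<rho>"
    using \<rho> by (intro eventually_nhds_in_open) auto
  then have "\<forall>\<^sub>F q in nhds z0. X q = x q \<and> Y q = y q"
    by (rule eventually_mono) (rule XY(2))
  \<comment> \<open>Connectedness of \<open>U\<close> carries the agreement from the small disc
    about \<open>z0\<close> to all of \<open>U\<close>.\<close>
  then have "X p = x p \<and> Y p = y p" if "p \<in> U" for p
    using meromorphic_solution_unique[OF assms(1,2) XY(1) sol assms(3)] that by blast
  then show ?thesis
    using meromorphic_solution_nicely_meromorphic[OF XY(1)] by blast
qed

end
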